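(* Let $k\ge 2$ and let $P(x,y)=\prod_{i=1}^k\ell_i(x,y)$, where $\ell_i(x,y)=a_ix+b_iy$, $i\in\{1,\dots,k\}$, are pairwise non-proportional real linear homogeneous polynomials. The second fundamental form of the surface $S\subset\mathbb{R}^3$ defined by the equation $z=P(x,y)$ defines globally two fields of asymptotic directions on the $xy$-plane. Moreover, each of these two fields satisfies the following properties: (i) it has only one singular point, which is the origin; (ii) there are $k$ rays that are asymptotic lines of it, all of them emanating from the origin; (iii) each sector between two adjacent such rays is hyperbolic.
   Context: The second fundamental form of the graph $z=P(x,y)$ is $\mathrm{II}_P=P_{xx}dx^2+2P_{xy}dx\,dy+P_{yy}dy^2$. The asymptotic directions at a point $(x,y)$ are the lines in $\mathbb{R}^2$ on which $\mathrm{II}_P(x,y)$ vanishes (asymptotic directions of the surface, projected to the $xy$-plane along the $z$-axis). An asymptotic line (asymptotic curve) of a field of asymptotic directions is an integral curve of that line field. "Hyperbolic sector" has its usual meaning for a line field near an isolated singular point: a sector bounded by two separatrices whose interior is filled by integral curves that do not tend to the singular point, but enter along one separatrix and leave along the other.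
   Formalization: For k=2 the second fundamental form is constant (e.g. P=xy), so the origin is not singular and (i) fails; the formal statement says each field has no singular point when k=2 and exactly the origin when k≥3. The fields live on the plane minus the origin; (ii), (iii) are kept for all k≥2. *)

theory Defs
  imports "HOL-Analysis.Analysis"
begin

definition partial_x :: "(real \<times> real \<Rightarrow> real) \<Rightarrow> real \<times> real \<Rightarrow> real" where
  "partial_x P = (\<lambda>(x, y). deriv (\<lambda>t. P (t, y)) x)"

definition partial_y :: "(real \<times> real \<Rightarrow> real) \<Rightarrow> real \<times> real \<Rightarrow> real" where
  "partial_y P = (\<lambda>(x, y). deriv (\<lambda>t. P (x, t)) y)"

text \<open>The second fundamental form of the graph \<open>z = P(x,y)\<close>, up to its positive normalising factor.\<close>

definition second_fundamental_form ::
    "(real \<times> real \<Rightarrow> real) \<Rightarrow> real \<times> real \<Rightarrow> real \<times> real \<Rightarrow> real" where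
  "second_fundamental_form P p = (\<lambda>(dx, dy).
     partial_x (partial_x P) p * dx\<^sup>2
     + 2 * partial_y (partial_x P) p * dx * dy
     + partial_y (partial_y P) p * dy\<^sup>2)"

definition asymptotic_direction ::
    "(real \<times> real \<Rightarrow> real) \<Rightarrow> real \<times> real \<Rightarrow> (real \<times> real) set \<Rightarrow> bool" where
  "asymptotic_direction P p L \<longleftrightarrow>
     subspace L \<and> dim L = 1 \<and> (\<forall>v\<in>L. second_fundamental_form P p v = 0)"

text \<open>A line field assigns to each point a one-dimensional subspace.  It is continuous when it is
  locally spanned by a continuous nowhere vanishing vector field; a global such vector field need
  not exist (the fields below are not orientable around the origin when the degree is odd).\<close>

definition line_field_on ::
    "(real \<times> real) set \<Rightarrow> (real \<times> real \<Rightarrow> (real \<times> real) set) \<Rightarrow> bool" where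
  "line_field_on D F \<longleftrightarrow>
     (\<forall>p\<in>D. \<exists>U v. open U \<and> p \<in> U \<and> continuous_on (U \<inter> D) v \<and>
        (\<forall>q\<in>U \<inter> D. v q \<noteq> (0 :: real \<times> real) \<and> F q = span {v q}))"

text \<open>All line fields below live on the punctured plane; the value of \<open>F\<close> at the origin is junk
  and is ignored by every definition that follows.\<close>

definition asymptotic_field ::
    "(real \<times> real \<Rightarrow> real) \<Rightarrow> (real \<times> real \<Rightarrow> (real \<times> real) set) \<Rightarrow> bool" where
  "asymptotic_field P F \<longleftrightarrow>
     line_field_on (- {0}) F \<and> (\<forall>p. p \<noteq> 0 \<longrightarrow> asymptotic_direction P p (F p))"

text \<open>A point is singular when the field, considered on a punctured neighbourhood of the point,
  does not extend to a continuous line field on a full neighbourhood.  For a product of two linear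
  forms the second fundamental form is constant, so both fields are constant and the origin is a
  removable singularity; it is still excluded from the domain, uniformly in the degree.\<close>

definition singular_point ::
    "(real \<times> real \<Rightarrow> (real \<times> real) set) \<Rightarrow> real \<times> real \<Rightarrow> bool" where
  "singular_point F p \<longleftrightarrow>
     \<not> (\<exists>\<epsilon>>0. \<exists>G. line_field_on (ball p \<epsilon>) G \<and> (\<forall>q\<in>ball p \<epsilon> - {p}. G q = F q))"

definition integral_curve ::
    "(real \<times> real \<Rightarrow> (real \<times> real) set) \<Rightarrow> real set \<Rightarrow> (real \<Rightarrow> real \<times> real) \<Rightarrow> bool" where
  "integral_curve F I \<gamma> \<longleftrightarrow>
     open I \<and> is_interval I \<and> I \<noteq> {} \<and>
     (\<exists>\<gamma>'. continuous_on I \<gamma>' \<and>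
        (\<forall>t\<in>I. (\<gamma> has_vector_derivative \<gamma>' t) (at t) \<and>
               \<gamma> t \<noteq> 0 \<and> \<gamma>' t \<noteq> 0 \<and> \<gamma>' t \<in> F (\<gamma> t)))"

text \<open>Asymptotic lines are maximal integral curves, regarded as subsets of the punctured plane.\<close>

definition asymptotic_line ::
    "(real \<times> real \<Rightarrow> (real \<times> real) set) \<Rightarrow> (real \<times> real) set \<Rightarrow> bool" where
  "asymptotic_line F C \<longleftrightarrow>
     (\<exists>I \<gamma>. integral_curve F I \<gamma> \<and> \<gamma> ` I = C) \<and>
     (\<forall>J \<delta>. integral_curve F J \<delta> \<and> \<delta> ` J \<inter> C \<noteq> {} \<longrightarrow> \<delta> ` J \<subseteq> C)"

definition unit_vector :: "real \<Rightarrow> real \<times> real" where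
  "unit_vector \<theta> = (cos \<theta>, sin \<theta>)"

definition ray :: "real \<times> real \<Rightarrow> real \<Rightarrow> (real \<times> real) set" where
  "ray p \<theta> = {p + t *\<^sub>R unit_vector \<theta> | t. t > 0}"

definition sector :: "real \<Rightarrow> real \<Rightarrow> (real \<times> real) set" where
  "sector \<alpha> \<beta> = {r *\<^sub>R unit_vector \<theta> | r \<theta>. r > 0 \<and> \<alpha> < \<theta> \<and> \<theta> < \<beta>}"

text \<open>A maximal integral curve inside the sector which comes in from infinity along the ray of
  angle \<open>\<alpha>\<close> and goes out to infinity along the ray of angle \<open>\<beta>\<close>.\<close>

definition traverses_sector ::
    "(real \<times> real \<Rightarrow> (real \<times> real) set) \<Rightarrow> real \<Rightarrow> real \<Rightarrow> real \<Rightarrow> real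
     \<Rightarrow> (real \<Rightarrow> real \<times> real) \<Rightarrow> bool" where
  "traverses_sector F \<alpha> \<beta> a b \<gamma> \<longleftrightarrow>
     a < b \<and> integral_curve F {a<..<b} \<gamma> \<and> asymptotic_line F (\<gamma> ` {a<..<b}) \<and>
     \<gamma> ` {a<..<b} \<subseteq> sector \<alpha> \<beta> \<and>
     filterlim (\<lambda>t. norm (\<gamma> t)) at_top (at_right a) \<and>
     ((\<lambda>t. \<gamma> t /\<^sub>R norm (\<gamma> t)) \<longlongrightarrow> unit_vector \<alpha>) (at_right a) \<and>
     filterlim (\<lambda>t. norm (\<gamma> t)) at_top (at_left b) \<and>
     ((\<lambda>t. \<gamma> t /\<^sub>R norm (\<gamma> t)) \<longlongrightarrow> unit_vector \<beta>) (at_left b)"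

text \<open>The two bounding rays are the separatrices.  The third conjunct describes the whole sector.
  The fourth is the picture near the singular point: in a disc of any radius \<open>\<rho>\<close>, the curves
  passing close to the origin enter the disc close to one separatrix and leave it close to the
  other.\<close>

definition hyperbolic_sector ::
    "(real \<times> real \<Rightarrow> (real \<times> real) set) \<Rightarrow> real \<Rightarrow> real \<Rightarrow> bool" where
  "hyperbolic_sector F \<alpha> \<beta> \<longleftrightarrow>
     asymptotic_line F (ray 0 \<alpha>) \<and> asymptotic_line F (ray 0 \<beta>) \<and>
     (\<forall>q\<in>sector \<alpha> \<beta>. \<exists>a b \<gamma>. traverses_sector F \<alpha> \<beta> a b \<gamma> \<and> q \<in> \<gamma> ` {a<..<b}) \<and>
     (\<forall>\<rho>>0. \<forall>\<eta>>0. \<exists>\<delta>>0. \<forall>q \<in> sector \<alpha> \<beta> \<inter> ball 0 \<delta>.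
        \<exists>a b \<gamma> s u. traverses_sector F \<alpha> \<beta> a b \<gamma> \<and> a < s \<and> s < u \<and> u < b \<and>
          q \<in> \<gamma> ` {s<..<u} \<and> \<gamma> ` {s<..<u} \<subseteq> ball 0 \<rho> \<and>
          norm (\<gamma> s) = \<rho> \<and> dist (\<gamma> s) (\<rho> *\<^sub>R unit_vector \<alpha>) < \<eta> \<and>
          norm (\<gamma> u) = \<rho> \<and> dist (\<gamma> u) (\<rho> *\<^sub>R unit_vector \<beta>) < \<eta>)"

text \<open>Angles are not reduced modulo \<open>2 * pi\<close>; the condition that no asymptotic ray lies strictly
  in between forces \<open>\<beta> \<le> \<alpha> + 2 * pi\<close>.\<close>

definition adjacent_asymptotic_rays ::
    "(real \<times> real \<Rightarrow> (real \<times> real) set) \<Rightarrow> real \<Rightarrow> real \<Rightarrow> bool" where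
  "adjacent_asymptotic_rays F \<alpha> \<beta> \<longleftrightarrow>
     \<alpha> < \<beta> \<and> asymptotic_line F (ray 0 \<alpha>) \<and> asymptotic_line F (ray 0 \<beta>) \<and>
     (\<forall>\<theta>. \<alpha> < \<theta> \<and> \<theta> < \<beta> \<longrightarrow> \<not> asymptotic_line F (ray 0 \<theta>))"

definition asymptotic_rays ::
    "(real \<times> real \<Rightarrow> (real \<times> real) set) \<Rightarrow> (real \<times> real) set set" where
  "asymptotic_rays F = {R. (\<exists>p \<theta>. R = ray p \<theta>) \<and> asymptotic_line F R}"

end

theory Submission
  imports Defs
begin

text \<open>Let \<open>M\<close> be the Hessian of \<open>P\<close> and \<open>J\<close> the rotation by a right angle. Since \<open>P\<close> is a product of
  distinct linear forms, \<open>det M < 0\<close> off the origin, and the two asymptotic lines at \<open>p\<close> are the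
  eigenlines of \<open>J M(p)\<close> for \<open>\<plusminus> sqrt (- det M)\<close>. Replacing \<open>P\<close> by \<open>- P\<close> exchanges the two fields, so
  only the field \<open>F\<close> of the positive eigenvalue has to be studied.

  By Euler's relation \<open>M p = (k - 1) grad P\<close>, the function \<open>P\<close> is monotone in the polar angle along
  every integral curve of \<open>F\<close>, and \<open>F\<close> is radial exactly where \<open>P = r\<^sup>k f(\<theta>)\<close> has \<open>f = 0\<close> and \<open>f' < 0\<close>.
  The signs of \<open>f'\<close> alternate along the \<open>2 k\<close> simple zeros of \<open>f\<close>, which leaves \<open>k\<close> rays. Between two
  adjacent ones, \<open>F\<close> is transverse to the radii, so its integral curves are the graphs
  \<open>r = exp (c + \<Phi>(\<theta>))\<close> of the homothets of a single curve, and monotonicity of \<open>r\<^sup>k f(\<theta>)\<close> together with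
  \<open>f \<rightarrow> 0\<close> forces \<open>r \<rightarrow> \<infinity>\<close> at both ends. Uniqueness of the integral curves also follows from this
  description.\<close>

subsection \<open>Plane vectors in polar form\<close>

text \<open>The factorisation gives the sign of \<open>det M\<close> and the number of zeros. Off
  the zeros, Euler's relation gives the Hessian on \<open>p\<close> the sign of \<open>P\<close>;
  along the tangent of the level curve the logarithmic derivatives of the factors add up to 0, so
  the Hessian there is minus the sum of their squares, times \<open>P\<close>. Both signs occur. At
  a zero, \<open>p\<close> is isotropic, and simplicity of the zero keeps it out of the kernel. The
  locale \<open>saddle_form\<close> collects what the rest is built on, in a form that survives
  \<open>P\<close> becoming \<open>- P\<close>. In odd degree the fields are not orientable around
  the origin, so no global vector field with a flow is at hand. In a sector the equation separates
  in polar coordinates: \<open>ln r - \<Phi> \<theta>\<close> is a first integral, which yields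
  existence and uniqueness by a single integration. On the radial rays uniqueness has another
  source: the direction of a curve takes values in a finite set.\<close>

definition wedge :: "real \<times> real \<Rightarrow> real \<times> real \<Rightarrow> real" where
  "wedge p q = fst p * snd q - snd p * fst q"

definition rot :: "real \<times> real \<Rightarrow> real \<times> real" where
  "rot p = (- snd p, fst p)"

lemma wedge_eq_0_imp_scaleR:
  assumes "wedge v w = 0" "w \<noteq> 0"
  obtains c where "v = c *\<^sub>R w"
proof -
  have "v = (if fst w = 0 then snd v / snd w else fst v / fst w) *\<^sub>R w"
    using assms by (auto simp: wedge_def prod_eq_iff field_simps)
  then show ?thesis using that by blast
qed

lemma wedge_unit_rot [simp]: "wedge (unit_vector t) (rot (unit_vector t)) = 1"
  by (simp add: wedge_def rot_def unit_vector_def flip: power2_eq_square)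

lemma norm_unit_vector [simp]: "norm (unit_vector t) = 1"
  by (simp add: unit_vector_def norm_Pair)

lemma unit_vector_nz [simp]: "unit_vector t \<noteq> 0"
  using norm_unit_vector[of t] by (metis norm_zero zero_neq_one)

lemma ex_unit_vector:
  assumes "norm p = 1"
  obtains t where "0 \<le> t" "t < 2 * pi" "p = unit_vector t"
proof -
  have "(fst p)\<^sup>2 + (snd p)\<^sup>2 = 1"
    using assms by (simp add: norm_prod_def)
  then show ?thesis
    using sincos_total_2pi[of "fst p" "snd p"] that by (metis prod.collapse unit_vector_def)
qed

lemma polar_form:
  assumes "p \<noteq> 0"
  obtains t where "0 \<le> t" "t < 2 * pi" "p = norm p *\<^sub>R unit_vector t"
proof -
  have "norm (p /\<^sub>R norm p) = 1" using assms by simp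
  then obtain t where "0 \<le> t" "t < 2 * pi" "p /\<^sub>R norm p = unit_vector t"
    by (rule ex_unit_vector)
  then show ?thesis using that assms by (metis divideR_right norm_eq_zero)
qed

lemma unit_vector_periodic: "unit_vector (t + 2 * pi) = unit_vector t"
  by (simp add: unit_vector_def)

lemma unit_vector_periodic_int: "unit_vector (t + 2 * pi * of_int n) = unit_vector t"
  using sin_cos_eq_iff[of "t + 2 * pi * of_int n" t]
  by (auto simp: unit_vector_def)

lemma inj_on_unit_vector: "inj_on unit_vector {a..<a + 2 * pi}"
proof (rule inj_onI)
  fix s t assume st: "s \<in> {a..<a + 2 * pi}" "t \<in> {a..<a + 2 * pi}" "unit_vector s = unit_vector t"
  then obtain n where n: "s = t + 2 * pi * of_int n"
    using sin_cos_eq_iff[of s t] by (auto simp: unit_vector_def)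
  have "\<bar>2 * pi * of_int n\<bar> < 2 * pi"
    using st(1,2) unfolding n atLeastLessThan_iff abs_less_iff by linarith
  then have "\<bar>of_int n\<bar> < (1::real)" by (simp add: abs_mult)
  then have "n = 0" by linarith
  then show "s = t" using n by simp
qed

lemma unit_vector_derivative:
  "(unit_vector has_vector_derivative rot (unit_vector t)) (at t)"
  unfolding unit_vector_def rot_def fst_conv snd_conv
  by (auto intro!: derivative_eq_intros has_vector_derivative_Pair
      simp flip: has_real_derivative_iff_has_vector_derivative)

lemma isCont_unit_vector: "isCont unit_vector t"
  using unit_vector_derivative has_vector_derivative_continuous by blast

lemma continuous_on_unit_vector [continuous_intros]:
  fixes f :: "'a::t2_space \<Rightarrow> real"
  shows "continuous_on S f \<Longrightarrow> continuous_on S (\<lambda>x. unit_vector (f x))"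
  unfolding unit_vector_def
  by (intro continuous_on_Pair continuous_on_cos continuous_on_sin)

lemma continuous_on_rot [continuous_intros]:
  "continuous_on S f \<Longrightarrow> continuous_on S (\<lambda>x. rot (f x))"
  unfolding rot_def by (intro continuous_intros)

lemma continuous_on_wedge [continuous_intros]:
  "continuous_on S f \<Longrightarrow> continuous_on S g \<Longrightarrow> continuous_on S (\<lambda>x. wedge (f x) (g x))"
  unfolding wedge_def by (intro continuous_intros)

lemma plane_frame:
  "v = (unit_vector t \<bullet> v) *\<^sub>R unit_vector t + wedge (unit_vector t) v *\<^sub>R rot (unit_vector t)"
proof -
  have "x = (c * x + s * y) * c - (c * y - s * x) * s \<and> y = (c * x + s * y) * s + (c * y - s * x) * c"
    if "s\<^sup>2 + c\<^sup>2 = 1" for x y s c :: real using that by algebra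
  from this[OF sin_cos_squared_add, of "fst v" t "snd v"] show ?thesis
    by (simp add: prod_eq_iff inner_prod_def unit_vector_def rot_def wedge_def mult.commute)
qed

lemma ray_0_eq: "ray 0 t = {r *\<^sub>R unit_vector t | r. r > 0}"
  by (simp add: ray_def)

lemma mem_ray_0_iff: "p \<in> ray 0 t \<longleftrightarrow> p \<noteq> 0 \<and> p /\<^sub>R norm p = unit_vector t"
proof
  show "p \<noteq> 0 \<and> p /\<^sub>R norm p = unit_vector t" if "p \<in> ray 0 t"
    using that by (auto simp: ray_0_eq)
  show "p \<in> ray 0 t" if "p \<noteq> 0 \<and> p /\<^sub>R norm p = unit_vector t"
    using that by (metis (mono_tags, lifting) divideR_right mem_Collect_eq norm_eq_zero ray_0_eq zero_less_norm_iff)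
qed

subsection \<open>Isotropic lines of an indefinite binary form\<close>

text \<open>If \<open>M\<close> is the symmetric matrix of the form and \<open>J\<close> the rotation by a right angle, then \<open>J M\<close>
  is traceless with eigenvalues \<open>\<plusminus> sqrt (B\<^sup>2 - A C)\<close>, and a vector is isotropic iff it is an
  eigenvector of \<open>J M\<close>. The line below is the eigenspace of the positive eigenvalue; negating the
  form gives the other one. This choice of branch commutes with rotations.\<close>

definition null_line :: "real \<Rightarrow> real \<Rightarrow> real \<Rightarrow> (real \<times> real) set" where
  "null_line A B C = {v. A * fst v + B * snd v = sqrt (B\<^sup>2 - A * C) * snd v \<and>
                         B * fst v + C * snd v = - (sqrt (B\<^sup>2 - A * C) * fst v)}"

text \<open>The symmetric bilinear form on \<open>v\<close> and \<open>w\<close> equals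
  \<open>s * wedge v w\<close> and, with the roles exchanged, \<open>s * wedge w v\<close>; symmetry
  leaves \<open>2 * s * wedge v w = 0\<close>.\<close>

lemma null_line_wedge:
  assumes "B\<^sup>2 - A * C > 0" "v \<in> null_line A B C" "w \<in> null_line A B C"
  shows "wedge v w = 0"
proof -
  define s where "s = sqrt (B\<^sup>2 - A * C)"
  have "s > 0" using assms(1) by (simp add: s_def)
  have "A * fst v + B * snd v = s * snd v" "B * fst v + C * snd v = - (s * fst v)"
       "A * fst w + B * snd w = s * snd w" "B * fst w + C * snd w = - (s * fst w)"
    using assms(2,3) by (auto simp: null_line_def s_def)
  then have "2 * s * wedge v w = 0" unfolding wedge_def by algebra
  then show ?thesis using \<open>s > 0\<close> by simp
qed

lemma subspace_null_line: "subspace (null_line A B C)"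
proof -
  define s where "s = sqrt (B\<^sup>2 - A * C)"
  have "A * (c * x) + B * (c * y) = s * (c * y) \<and> B * (c * x) + C * (c * y) = - (s * (c * x))"
    if "A * x + B * y = s * y" "B * x + C * y = - (s * x)" for c x y
    using that by algebra
  then show ?thesis
    unfolding subspace_def null_line_def s_def[symmetric] by (auto simp: distrib_left)
qed

lemma null_line_eq_span:
  assumes "B\<^sup>2 - A * C > 0" "w \<in> null_line A B C" "w \<noteq> 0"
  shows "null_line A B C = span {w}"
proof
  show "span {w} \<subseteq> null_line A B C"
    using assms(2) by (simp add: span_minimal subspace_null_line)
  show "null_line A B C \<subseteq> span {w}"
  proof
    fix v assume "v \<in> null_line A B C"
    then have "wedge v w = 0" using null_line_wedge assms by blast
    then obtain c where "v = c *\<^sub>R w" using wedge_eq_0_imp_scaleR assms(3) by blast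
    then show "v \<in> span {w}" by (simp add: span_base span_mul)
  qed
qed

text \<open>Each row of the eigenvector equations suggests one vector. Either may vanish, but not
  both: \<open>B\<close> would have to equal the positive root and its negative at once. Hence a
  spanning vector can be chosen continuously near any point, though perhaps not globally.\<close>

lemma null_line_generators:
  assumes "B\<^sup>2 - A * C > 0"
  shows "(sqrt (B\<^sup>2 - A * C) - B, A) \<in> null_line A B C"
    "(C, - B - sqrt (B\<^sup>2 - A * C)) \<in> null_line A B C"
    "(sqrt (B\<^sup>2 - A * C) - B, A) \<noteq> 0 \<or> (C, - B - sqrt (B\<^sup>2 - A * C)) \<noteq> 0"
proof -
  define s where "s = sqrt (B\<^sup>2 - A * C)"
  have s: "s > 0" "s\<^sup>2 = B\<^sup>2 - A * C" using assms by (simp_all add: s_def)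
  have "A * (s - B) + B * A = s * A" "B * C + C * (- B - s) = - (s * C)"
    by (simp_all add: algebra_simps)
  moreover have "B * (s - B) + C * A = - (s * (s - B))" "A * C + B * (- B - s) = s * (- B - s)"
    using s(2) by algebra+
  ultimately show "(sqrt (B\<^sup>2 - A * C) - B, A) \<in> null_line A B C"
    "(C, - B - sqrt (B\<^sup>2 - A * C)) \<in> null_line A B C"
    by (auto simp: null_line_def s_def)
  show "(sqrt (B\<^sup>2 - A * C) - B, A) \<noteq> 0 \<or> (C, - B - sqrt (B\<^sup>2 - A * C)) \<noteq> 0"
    unfolding s_def[symmetric] using s(1) by (auto simp: zero_prod_def)
qed

lemma null_line_nonzero:
  assumes "B\<^sup>2 - A * C > 0"
  obtains w where "w \<in> null_line A B C" "w \<noteq> 0"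
  using null_line_generators[OF assms] by blast

lemma dim_null_line:
  assumes "B\<^sup>2 - A * C > 0"
  shows "dim (null_line A B C) = 1"
proof -
  obtain w where "w \<in> null_line A B C" "w \<noteq> 0" using null_line_nonzero[OF assms] .
  then show ?thesis
    using null_line_eq_span[OF assms] by (metis dim_singleton dim_span)
qed

lemma isotropic_iff_null_line:
  assumes "B\<^sup>2 - A * C > 0"
  shows "A * (fst v)\<^sup>2 + 2 * B * fst v * snd v + C * (snd v)\<^sup>2 = 0 \<longleftrightarrow>
    v \<in> null_line A B C \<or> v \<in> null_line (- A) (- B) (- C)"
proof -
  define s where "s = sqrt (B\<^sup>2 - A * C)"
  have s: "s > 0" "s\<^sup>2 = B\<^sup>2 - A * C" using assms by (simp_all add: s_def)
  obtain x y where v: "v = (x, y)" by force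
  have N: "v \<in> null_line A B C \<longleftrightarrow> A * x + B * y = s * y \<and> B * x + C * y = - (s * x)"
    "v \<in> null_line (- A) (- B) (- C) \<longleftrightarrow> A * x + B * y = - (s * y) \<and> B * x + C * y = s * x"
    by (auto simp: null_line_def v s_def)
  \<comment> \<open>The first two products settle each row up to sign; the two mixed ones make the
    signs of the rows agree. Nothing is divided by \<open>A\<close> or \<open>C\<close>, which may
    vanish.\<close>
  have "(A * x + B * y - s * y) * (A * x + B * y + s * y) = A * (A * x\<^sup>2 + 2 * B * x * y + C * y\<^sup>2)"
    "(B * x + C * y - s * x) * (B * x + C * y + s * x) = C * (A * x\<^sup>2 + 2 * B * x * y + C * y\<^sup>2)"
    "(A * x + B * y - s * y) * (B * x + C * y - s * x) = (B - s) * (A * x\<^sup>2 + 2 * B * x * y + C * y\<^sup>2)"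
    "(A * x + B * y + s * y) * (B * x + C * y + s * x) = (B + s) * (A * x\<^sup>2 + 2 * B * x * y + C * y\<^sup>2)"
    using s(2) by algebra+
  then have "v \<in> null_line A B C \<or> v \<in> null_line (- A) (- B) (- C)"
    if Q: "A * x\<^sup>2 + 2 * B * x * y + C * y\<^sup>2 = 0"
    using s(1) that unfolding N by (auto simp: add_eq_0_iff2)
  moreover have "A * x\<^sup>2 + 2 * B * x * y + C * y\<^sup>2 = 0"
    if "v \<in> null_line A B C \<or> v \<in> null_line (- A) (- B) (- C)"
    using that unfolding N by (elim disjE conjE) algebra+
  ultimately show ?thesis by (auto simp: v)
qed

lemma null_lines_disjoint:
  assumes "B\<^sup>2 - A * C > 0" "v \<in> null_line A B C" "v \<in> null_line (- A) (- B) (- C)"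
  shows "v = 0"
proof -
  have "sqrt (B\<^sup>2 - A * C) > 0" using assms(1) by simp
  moreover have "sqrt (B\<^sup>2 - A * C) * fst v = 0 \<and> sqrt (B\<^sup>2 - A * C) * snd v = 0"
    using assms(2,3)
    unfolding null_line_def mem_Collect_eq power2_minus mult_minus_left mult_minus_right minus_minus
    by (intro conjI; linarith)
  ultimately show ?thesis by (auto simp: prod_eq_iff)
qed

lemma isotropic_lines:
  assumes D: "B\<^sup>2 - A * C > 0"
  shows "{L. subspace L \<and> dim L = 1 \<and>
      (\<forall>v\<in>L. A * (fst v)\<^sup>2 + 2 * B * fst v * snd v + C * (snd v)\<^sup>2 = 0)}
    = {null_line A B C, null_line (- A) (- B) (- C)}" (is "?S = _")
proof -
  have D': "(- B)\<^sup>2 - (- A) * (- C) > 0" using D by simp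
  have "L = null_line A B C \<or> L = null_line (- A) (- B) (- C)" if "L \<in> ?S" for L
  proof -
    have "L \<noteq> {0}" using that by (auto)
    moreover have "0 \<in> L" using that subspace_0 by blast
    ultimately obtain w where w: "w \<in> L" "w \<noteq> 0" by blast
    then have "span {w} \<subseteq> L" using that by (simp add: span_minimal)
    then have L: "L = span {w}"
      using that w subspace_dim_equal[of "span {w}" L] by simp
    have "w \<in> null_line A B C \<or> w \<in> null_line (- A) (- B) (- C)"
      using w that isotropic_iff_null_line[OF D] by blast
    then show ?thesis
      using null_line_eq_span[OF D _ w(2)] null_line_eq_span[OF D' _ w(2)] L by blast
  qed
  moreover have "null_line A B C \<in> ?S" "null_line (- A) (- B) (- C) \<in> ?S"
    using isotropic_iff_null_line[OF D] dim_null_line[OF D] dim_null_line[OF D'] subspace_null_line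
    by blast+
  ultimately show ?thesis by blast
qed

lemma line_field_on_null_line:
  fixes A B C :: "real \<times> real \<Rightarrow> real"
  assumes cont: "continuous_on UNIV A" "continuous_on UNIV B" "continuous_on UNIV C"
    and D: "\<And>p. p \<in> D \<Longrightarrow> (B p)\<^sup>2 - A p * C p > 0"
  shows "line_field_on D (\<lambda>p. null_line (A p) (B p) (C p))"
  unfolding line_field_on_def
proof
  fix p assume p: "p \<in> D"
  have *: "\<exists>U v. open U \<and> p \<in> U \<and> continuous_on (U \<inter> D) v \<and>
        (\<forall>q\<in>U \<inter> D. v q \<noteq> 0 \<and> null_line (A q) (B q) (C q) = span {v q})"
    if w: "continuous_on UNIV w" "w p \<noteq> 0" "\<And>q. q \<in> D \<Longrightarrow> w q \<in> null_line (A q) (B q) (C q)"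
    for w :: "real \<times> real \<Rightarrow> real \<times> real"
  proof (intro exI conjI ballI)
    show "open {q. w q \<noteq> 0}" using w(1) by (intro open_Collect_neq continuous_intros)
    show "continuous_on ({q. w q \<noteq> 0} \<inter> D) w" using w(1) continuous_on_subset by blast
    show "null_line (A q) (B q) (C q) = span {w q}" if "q \<in> {q. w q \<noteq> 0} \<inter> D" for q
      using that w(3) D by (intro null_line_eq_span) auto
  qed (use w(2) in auto)
  have "continuous_on UNIV (\<lambda>q. (sqrt ((B q)\<^sup>2 - A q * C q) - B q, A q))"
    "continuous_on UNIV (\<lambda>q. (C q, - B q - sqrt ((B q)\<^sup>2 - A q * C q)))"
    by (intro continuous_intros cont)+
  note cont2 = this
  show "\<exists>U v. open U \<and> p \<in> U \<and> continuous_on (U \<inter> D) v \<and>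
        (\<forall>q\<in>U \<inter> D. v q \<noteq> 0 \<and> null_line (A q) (B q) (C q) = span {v q})"
    using null_line_generators(3)[OF D[OF p]]
  proof
    assume "(sqrt ((B p)\<^sup>2 - A p * C p) - B p, A p) \<noteq> 0"
    then show ?thesis using null_line_generators(1)[OF D] by (intro *[OF cont2(1)])
  next
    assume "(C p, - B p - sqrt ((B p)\<^sup>2 - A p * C p)) \<noteq> 0"
    then show ?thesis using null_line_generators(2)[OF D] by (intro *[OF cont2(2)])
  qed
qed

section \<open>Homogeneous saddle functions and the eigenline field \<open>F\<close>\<close>

locale saddle_form =
  fixes k :: nat and P Px Py A B C :: "real \<times> real \<Rightarrow> real"
  assumes k_ge_2: "2 \<le> k"
    and cont_A: "continuous_on UNIV A" and cont_B: "continuous_on UNIV B" and cont_C: "continuous_on UNIV C"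
    and P_derivative: "\<And>p. (P has_derivative (\<lambda>h. Px p * fst h + Py p * snd h)) (at p)"
    and euler: "\<And>p. fst p * Px p + snd p * Py p = real k * P p"
    and euler_x: "\<And>p. fst p * A p + snd p * B p = (real k - 1) * Px p"
    and euler_y: "\<And>p. fst p * B p + snd p * C p = (real k - 1) * Py p"
    and A_homogeneous: "\<And>r p. A (r *\<^sub>R p) = r ^ (k - 2) * A p"
    and B_homogeneous: "\<And>r p. B (r *\<^sub>R p) = r ^ (k - 2) * B p"
    and C_homogeneous: "\<And>r p. C (r *\<^sub>R p) = r ^ (k - 2) * C p"
    and discriminant_pos: "\<And>p. p \<noteq> 0 \<Longrightarrow> (B p)\<^sup>2 - A p * C p > 0"
    and card_zeros: "card {z. norm z = 1 \<and> P z = 0} = 2 * k"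
begin

lemma k_pos: "real k - 1 > 0" "real k > 0"
  using k_ge_2 by auto

lemma saddle_form_uminus:
  "saddle_form k (\<lambda>p. - P p) (\<lambda>p. - Px p) (\<lambda>p. - Py p) (\<lambda>p. - A p) (\<lambda>p. - B p) (\<lambda>p. - C p)"
proof
  show "((\<lambda>p. - P p) has_derivative (\<lambda>h. - Px p * fst h + - Py p * snd h)) (at p)" for p
    using has_derivative_minus[OF P_derivative[of p]] by (simp add: algebra_simps)
  show "fst p * - Px p + snd p * - Py p = real k * - P p" for p
    using euler[of p] by (simp add: algebra_simps)
  show "fst p * - A p + snd p * - B p = (real k - 1) * - Px p" for p
    using euler_x[of p] by (simp add: algebra_simps)
  show "fst p * - B p + snd p * - C p = (real k - 1) * - Py p" for p
    using euler_y[of p] by (simp add: algebra_simps)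
qed (use k_ge_2 cont_A cont_B cont_C A_homogeneous B_homogeneous C_homogeneous discriminant_pos card_zeros
     in \<open>auto intro!: continuous_intros\<close>)

definition F :: "real \<times> real \<Rightarrow> (real \<times> real) set" where
  "F p = null_line (A p) (B p) (C p)"

definition S :: "real \<times> real \<Rightarrow> real" where
  "S p = sqrt ((B p)\<^sup>2 - A p * C p)"

lemma S_pos: "p \<noteq> 0 \<Longrightarrow> S p > 0"
  using discriminant_pos by (simp add: S_def)

lemma mem_F_iff: "v \<in> F p \<longleftrightarrow> A p * fst v + B p * snd v = S p * snd v \<and>
    B p * fst v + C p * snd v = - (S p * fst v)"
  by (simp add: F_def S_def null_line_def)

lemma subspace_F: "subspace (F p)"
  by (simp add: F_def subspace_null_line)

lemma F_scaleR: "v \<in> F p \<Longrightarrow> c *\<^sub>R v \<in> F p"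
  using subspace_F subspace_scale by blast

lemma F_wedge: "p \<noteq> 0 \<Longrightarrow> v \<in> F p \<Longrightarrow> w \<in> F p \<Longrightarrow> wedge v w = 0"
  using null_line_wedge discriminant_pos unfolding F_def by blast

lemma F_nonzero:
  assumes "p \<noteq> 0"
  obtains w where "w \<in> F p" "w \<noteq> 0"
  using null_line_nonzero discriminant_pos[OF assms] unfolding F_def by blast

text \<open>The Hessian is multiplied by a positive factor. For negative \<open>r\<close> and odd
  \<open>k\<close> the factor is negative and the two fields are exchanged, which is why half-lines
  rather than full lines are counted.\<close>

lemma F_homogeneous:
  assumes "r > 0"
  shows "F (r *\<^sub>R p) = F p"
proof -
  define c where "c = r ^ (k - 2)"
  have c: "c > 0" using assms by (simp add: c_def)
  have "(c * B p)\<^sup>2 - (c * A p) * (c * C p) = c\<^sup>2 * ((B p)\<^sup>2 - A p * C p)"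
    by (simp add: algebra_simps power2_eq_square)
  then have S: "S (r *\<^sub>R p) = c * S p"
    using c by (simp add: S_def A_homogeneous B_homogeneous C_homogeneous real_sqrt_mult flip: c_def)
  have "v \<in> F (r *\<^sub>R p) \<longleftrightarrow> v \<in> F p" for v
  proof -
    have "v \<in> F (r *\<^sub>R p) \<longleftrightarrow> c * (A p * fst v + B p * snd v) = c * (S p * snd v) \<and>
        c * (B p * fst v + C p * snd v) = c * (- (S p * fst v))"
      unfolding mem_F_iff S A_homogeneous B_homogeneous C_homogeneous c_def[symmetric]
      by (simp add: algebra_simps)
    also have "\<dots> \<longleftrightarrow> v \<in> F p" using c unfolding mem_F_iff by (simp only: mult_left_cancel)
    finally show ?thesis .
  qed
  then show ?thesis by blast
qed

lemma line_field_on_F: "0 \<notin> D \<Longrightarrow> line_field_on D F"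
  unfolding F_def by (intro line_field_on_null_line cont_A cont_B cont_C discriminant_pos) auto

lemma continuous_on_S [continuous_intros]:
  assumes "continuous_on D g"
  shows "continuous_on D (\<lambda>x. S (g x))"
proof -
  have "continuous_on UNIV S" unfolding S_def by (intro continuous_intros cont_A cont_B cont_C)
  then show ?thesis using assms by (rule continuous_on_compose2) auto
qed

text \<open>\<open>P\<close> is strictly monotone in the polar angle along integral curves of \<open>F\<close>.\<close>

lemma gradient_on_F:
  assumes "v \<in> F p"
  shows "(real k - 1) * (Px p * fst v + Py p * snd v) = S p * wedge p v"
proof -
  have "A p * fst v + B p * snd v = S p * snd v" "B p * fst v + C p * snd v = - (S p * fst v)"
    using assms by (auto simp: mem_F_iff)
  then show ?thesis
    using euler_x[of p] euler_y[of p] unfolding wedge_def by algebra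
qed

text \<open>Derivative of \<open>P\<close> in the direction \<open>rot p\<close>; on the unit
  circle, the derivative of \<open>P\<close> in the angle.\<close>

definition T :: "real \<times> real \<Rightarrow> real" where
  "T p = Py p * fst p - Px p * snd p"

lemma gradient_nonzero:
  assumes "p \<noteq> 0"
  shows "Px p \<noteq> 0 \<or> Py p \<noteq> 0"
proof (rule ccontr)
  assume "\<not> ?thesis"
  then have *: "fst p * A p + snd p * B p = 0" "fst p * B p + snd p * C p = 0"
    using euler_x[of p] euler_y[of p] by auto
  have "((B p)\<^sup>2 - A p * C p) * fst p = 0" "((B p)\<^sup>2 - A p * C p) * snd p = 0"
    using * by algebra+
  then show False using discriminant_pos[OF assms] assms by (auto simp: prod_eq_iff)
qed

text \<open>At a zero, Euler's relation kills the radial part of the gradient, so the angular part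
  \<open>T p\<close> carries all of it.\<close>

lemma simple_zeros:
  assumes "p \<noteq> 0" "P p = 0"
  shows "T p \<noteq> 0"
proof
  assume "T p = 0"
  moreover have "fst p * Px p + snd p * Py p = 0" using euler[of p] assms by simp
  ultimately have "((fst p)\<^sup>2 + (snd p)\<^sup>2) * Px p = 0" "((fst p)\<^sup>2 + (snd p)\<^sup>2) * Py p = 0"
    unfolding T_def by algebra+
  moreover have "(fst p)\<^sup>2 + (snd p)\<^sup>2 \<noteq> 0" using assms(1) by (simp add: prod_eq_iff sum_power2_eq_zero_iff)
  ultimately show False using gradient_nonzero[OF assms(1)] by auto
qed

text \<open>Since \<open>M p\<close> is \<open>k - 1\<close> times the gradient, \<open>p\<close> is
  an eigenvector of \<open>J M\<close> exactly when the gradient is orthogonal to \<open>p\<close>,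
  that is, when \<open>P p = 0\<close>. The eigenvalue then has the sign of \<open>- T p\<close>,
  and \<open>F\<close> takes the positive one.\<close>

lemma radial_iff:
  assumes "p \<noteq> 0"
  shows "p \<in> F p \<longleftrightarrow> P p = 0 \<and> T p < 0"
proof
  assume "p \<in> F p"
  then have 1: "(real k - 1) * Px p = S p * snd p" "(real k - 1) * Py p = - (S p * fst p)"
    using euler_x[of p] euler_y[of p] unfolding mem_F_iff by (simp_all add: algebra_simps)
  have "(real k - 1) * (real k * P p) = 0"
    using 1 euler[of p] by algebra
  moreover have "(real k - 1) * T p = - (S p * ((fst p)\<^sup>2 + (snd p)\<^sup>2))"
    using 1 unfolding T_def by algebra
  moreover have "S p * ((fst p)\<^sup>2 + (snd p)\<^sup>2) > 0"
    using S_pos[OF assms] assms by (simp add: prod_eq_iff sum_power2_gt_zero_iff)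
  ultimately have "(real k - 1) * (real k * P p) = 0" "(real k - 1) * T p < 0" by linarith+
  then show "P p = 0 \<and> T p < 0" using k_pos
    by (metis less_numeral_extra(3) mult_eq_0_iff mult_less_0_iff not_less_iff_gr_or_eq)
next
  assume *: "P p = 0 \<and> T p < 0"
  define n where "n = (fst p)\<^sup>2 + (snd p)\<^sup>2"
  have n: "n > 0" using assms by (simp add: n_def prod_eq_iff sum_power2_gt_zero_iff)
  have E: "fst p * Px p + snd p * Py p = 0" using euler[of p] * by simp
  have g: "n * Px p = - (T p * snd p)" "n * Py p = T p * fst p"
    using E unfolding T_def n_def by algebra+
  \<comment> \<open>Eigenvalue of \<open>J M\<close> at \<open>p\<close>, found by comparing
    \<open>M p\<close> with the gradient; its square must be \<open>- det M\<close>, and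
    \<open>T p < 0\<close> makes it the positive root.\<close>
  define l where "l = - ((real k - 1) * T p / n)"
  have l: "l > 0" using * n k_pos by (simp add: l_def divide_less_0_iff mult_less_0_iff)
  have nl: "n * l = - ((real k - 1) * T p)" using n by (simp add: l_def)
  have m: "A p * fst p + B p * snd p = l * snd p" "B p * fst p + C p * snd p = - (l * fst p)"
  proof -
    have "n * (A p * fst p + B p * snd p) = n * (l * snd p)"
         "n * (B p * fst p + C p * snd p) = n * (- (l * fst p))"
      using g nl euler_x[of p] euler_y[of p] by algebra+
    then show "A p * fst p + B p * snd p = l * snd p" "B p * fst p + C p * snd p = - (l * fst p)"
      using n by (simp_all only: mult_left_cancel)
  qed
  have "fst p * (l\<^sup>2 - ((B p)\<^sup>2 - A p * C p)) = 0" "snd p * (l\<^sup>2 - ((B p)\<^sup>2 - A p * C p)) = 0"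
    using m by algebra+
  then have "l\<^sup>2 = (B p)\<^sup>2 - A p * C p" using assms by (auto simp: prod_eq_iff)
  then have "S p = l" using l by (simp add: S_def real_sqrt_unique)
  then show "p \<in> F p" using m by (simp add: mem_F_iff)
qed

text \<open>Applying Euler's relations twice gives \<open>k * (k - 1) * P p\<close> as the Hessian
  form evaluated on \<open>p\<close> itself, so the degree of \<open>P\<close> follows from that of
  \<open>A\<close>, \<open>B\<close>, \<open>C\<close>.\<close>

lemma P_homogeneous: "P (r *\<^sub>R p) = r ^ k * P p"
proof -
  have *: "(real k - 1) * (real k * P q) = (fst q)\<^sup>2 * A q + 2 * fst q * snd q * B q + (snd q)\<^sup>2 * C q" for q
    using euler_x[of q] euler_y[of q] euler[of q] by algebra
  have "r ^ k = r ^ (k - 2) * r\<^sup>2" using k_ge_2 by (metis le_add_diff_inverse2 power_add)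
  then have "(real k - 1) * (real k * P (r *\<^sub>R p)) = r ^ k * ((real k - 1) * (real k * P p))"
    unfolding * A_homogeneous B_homogeneous C_homogeneous fst_scaleR snd_scaleR real_scaleR_def
    by (simp add: algebra_simps power2_eq_square)
  then show ?thesis using k_pos by simp
qed

lemma continuous_on_P [continuous_intros]:
  "continuous_on D g \<Longrightarrow> continuous_on D (\<lambda>x. P (g x))"
  by (rule continuous_on_compose2[where g = P and t = UNIV])
    (auto intro!: continuous_at_imp_continuous_on has_derivative_continuous[OF P_derivative])

lemma continuous_on_T [continuous_intros]:
  assumes "continuous_on D g"
  shows "continuous_on D (\<lambda>x. T (g x))"
proof -
  have "Px = (\<lambda>p. (fst p * A p + snd p * B p) / (real k - 1))"
       "Py = (\<lambda>p. (fst p * B p + snd p * C p) / (real k - 1))"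
    using k_pos by (auto simp: euler_x euler_y)
  moreover have "continuous_on UNIV (\<lambda>p. (fst p * A p + snd p * B p) / (real k - 1))"
      "continuous_on UNIV (\<lambda>p. (fst p * B p + snd p * C p) / (real k - 1))"
    using k_pos by (auto intro!: continuous_intros cont_A cont_B cont_C)
  ultimately have "continuous_on UNIV Px" "continuous_on UNIV Py" by simp_all
  then have "continuous_on UNIV T" unfolding T_def by (intro continuous_intros)
  then show ?thesis using assms by (rule continuous_on_compose2) auto
qed

subsection \<open>The angular part of \<open>P\<close> and the radial directions\<close>

definition f :: "real \<Rightarrow> real" where "f t = P (unit_vector t)"

definition f' :: "real \<Rightarrow> real" where "f' t = T (unit_vector t)"

lemma f_derivative: "(f has_real_derivative f' t) (at t)"
proof -
  have "((\<lambda>t. P (unit_vector t)) has_derivative (\<lambda>h. Px (unit_vector t) * fst (h *\<^sub>R rot (unit_vector t)) +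
      Py (unit_vector t) * snd (h *\<^sub>R rot (unit_vector t)))) (at t)"
    using has_derivative_compose[OF unit_vector_derivative[unfolded has_vector_derivative_def] P_derivative] .
  then show ?thesis
    unfolding f_def[symmetric] has_field_derivative_def
    by (rule has_derivative_eq_rhs) (auto simp: f'_def T_def rot_def algebra_simps)
qed

lemma continuous_on_f [continuous_intros]: "continuous_on D g \<Longrightarrow> continuous_on D (\<lambda>x. f (g x))"
  for g :: "'a::t2_space \<Rightarrow> real"
  unfolding f_def by (intro continuous_intros)

lemma continuous_on_f' [continuous_intros]: "continuous_on D g \<Longrightarrow> continuous_on D (\<lambda>x. f' (g x))"
  for g :: "'a::t2_space \<Rightarrow> real"
  unfolding f'_def by (intro continuous_intros)

lemma f_simple_zero: "f t = 0 \<Longrightarrow> f' t \<noteq> 0"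
  using simple_zeros[of "unit_vector t"] by (simp add: f_def f'_def)

definition radial :: "real \<Rightarrow> bool" where "radial t \<longleftrightarrow> unit_vector t \<in> F (unit_vector t)"

lemma radial_iff_f: "radial t \<longleftrightarrow> f t = 0 \<and> f' t < 0"
  by (simp add: radial_def radial_iff f_def f'_def)

lemma radial_scaleR_iff: "r > 0 \<Longrightarrow> r *\<^sub>R unit_vector t \<in> F (r *\<^sub>R unit_vector t) \<longleftrightarrow> radial t"
  using F_scaleR[of "r *\<^sub>R unit_vector t" "unit_vector t" "1 / r"]
    F_scaleR[of "unit_vector t" "unit_vector t" r]
  by (auto simp: radial_def F_homogeneous)

text \<open>At the zeros of \<open>f\<close> the derivative \<open>f'\<close> does not vanish, so
  its strict sign can be relaxed to a closed condition.\<close>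

lemma closed_radial: "closed {t. radial t}"
proof -
  have "{t. radial t} = {t. f t = 0} \<inter> {t. f' t \<le> 0}"
    using f_simple_zero by (fastforce simp: radial_iff_f)
  then show ?thesis
    by (auto intro!: closed_Int closed_Collect_eq closed_Collect_le continuous_intros)
qed

end

subsection \<open>The integral curves in a sector without radial directions\<close>

context saddle_form
begin

text \<open>Slope of \<open>F\<close> in polar coordinates: integral curves parametrised by the
  angle satisfy d(ln r)/d\<theta> = phi(\<theta>), independent of the radius by homogeneity.\<close>

definition phi :: "real \<Rightarrow> real" where
  "phi t = (THE r. r *\<^sub>R unit_vector t + rot (unit_vector t) \<in> F (unit_vector t))"

lemma multiple_unit_in_F:
  assumes "\<not> radial t" "c *\<^sub>R unit_vector t \<in> F (unit_vector t)"
  shows "c = 0"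
proof (rule ccontr)
  assume "c \<noteq> 0"
  then show False using assms(1) F_scaleR[OF assms(2), of "1 / c"] by (simp add: radial_def)
qed

lemma phi_mem:
  assumes "\<not> radial t"
  shows "phi t *\<^sub>R unit_vector t + rot (unit_vector t) \<in> F (unit_vector t)"
proof -
  let ?u = "unit_vector t"
  obtain w where w: "w \<in> F ?u" "w \<noteq> 0" using F_nonzero[of ?u] by auto
  have "wedge ?u w \<noteq> 0"
  proof
    assume "wedge ?u w = 0"
    then have eq: "w = (?u \<bullet> w) *\<^sub>R ?u" using plane_frame[of w t] by simp
    then have "?u \<bullet> w = 0" using w(1) multiple_unit_in_F[OF assms] by metis
    then show False using eq w(2) by simp
  qed
  moreover have "(1 / wedge ?u w) *\<^sub>R w \<in> F ?u" using w(1) by (rule F_scaleR)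
  ultimately have ex: "((?u \<bullet> w) / wedge ?u w) *\<^sub>R ?u + rot ?u \<in> F ?u"
    by (subst (asm) (2) plane_frame[of w t]) (simp add: scaleR_add_right)
  show ?thesis
    unfolding phi_def
  proof (rule theI)
    fix r assume r: "r *\<^sub>R ?u + rot ?u \<in> F ?u"
    have "(r - (?u \<bullet> w) / wedge ?u w) *\<^sub>R ?u \<in> F ?u"
      using subspace_diff[OF subspace_F r ex] by (simp add: scaleR_left_diff_distrib)
    then show "r = (?u \<bullet> w) / wedge ?u w" using multiple_unit_in_F[OF assms] by fastforce
  qed (rule ex)
qed

lemma phi_slope:
  assumes "\<not> radial t" "v \<in> F (unit_vector t)"
  shows "unit_vector t \<bullet> v = phi t * wedge (unit_vector t) v"
proof -
  let ?u = "unit_vector t"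
  let ?y = "wedge ?u v"
  have "v - ?y *\<^sub>R (phi t *\<^sub>R ?u + rot ?u) \<in> F ?u"
    by (intro subspace_diff[OF subspace_F] F_scaleR phi_mem assms)
  also have "v - ?y *\<^sub>R (phi t *\<^sub>R ?u + rot ?u) = (?u \<bullet> v - phi t * ?y) *\<^sub>R ?u"
    by (subst (1) plane_frame[of v t]) (simp add: algebra_simps)
  finally show ?thesis using multiple_unit_in_F[OF assms(1)] by fastforce
qed

text \<open>For any local spanning field the slope is the quotient of its radial by its angular
  component, so \<open>phi\<close> inherits the continuity of the line field.\<close>

lemma isCont_phi:
  assumes "\<not> radial t"
  shows "isCont phi t"
proof -
  obtain U v where U: "open U" "unit_vector t \<in> U" "continuous_on (U \<inter> - {0}) v"
      "\<And>q. q \<in> U - {0} \<Longrightarrow> v q \<noteq> 0 \<and> F q = span {v q}"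
    using line_field_on_F[of "- {0}"] unfolding line_field_on_def
    by (metis ComplI Diff_eq DiffD2 Compl_iff insert_iff singletonD singletonI unit_vector_nz)
  define V where "V = {s. unit_vector s \<in> U} \<inter> - {s. radial s}"
  have "open V"
    unfolding V_def using closed_radial U(1)
    by (intro open_Int open_Compl open_vimage[unfolded vimage_def] continuous_intros) auto
  have eq: "phi s = (unit_vector s \<bullet> v (unit_vector s)) / wedge (unit_vector s) (v (unit_vector s))
      \<and> wedge (unit_vector s) (v (unit_vector s)) \<noteq> 0" if "s \<in> V" for s
  proof -
    let ?u = "unit_vector s" let ?v = "v ?u"
    have v: "?v \<noteq> 0" "F ?u = span {?v}" using U(4)[of ?u] that by (auto simp: V_def)
    have *: "?u \<bullet> ?v = phi s * wedge ?u ?v"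
      using that v(2) by (intro phi_slope) (auto simp: V_def span_base)
    then have "wedge ?u ?v \<noteq> 0" using plane_frame[of ?v s] v(1) by auto
    then show ?thesis using * by simp
  qed
  have "continuous_on V (\<lambda>s. v (unit_vector s))"
    by (rule continuous_on_compose2[OF U(3)]) (auto simp: V_def intro!: continuous_intros)
  then have "continuous_on V
      (\<lambda>s. (unit_vector s \<bullet> v (unit_vector s)) / wedge (unit_vector s) (v (unit_vector s)))"
    using eq by (intro continuous_intros) auto
  then have "continuous_on V phi" using eq by (subst continuous_on_cong[OF refl]) auto
  then show ?thesis
    using \<open>open V\<close> U(2) assms by (auto simp: V_def continuous_on_eq_continuous_at)
qed

text \<open>\<open>gradient_on_F\<close> applied to the spanning vector that defines
  \<open>phi\<close>. The bracket is the angular derivative of \<open>r ^ k * f \<theta>\<close>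
  along an integral curve, divided by \<open>r ^ k\<close>; the right side makes it
  positive.\<close>

lemma phi_f:
  assumes "\<not> radial t"
  shows "(real k - 1) * (real k * phi t * f t + f' t) = S (unit_vector t)"
proof -
  let ?u = "unit_vector t" let ?v = "phi t *\<^sub>R ?u + rot ?u"
  have w: "wedge ?u ?v = 1"
    using wedge_unit_rot[of t] by (simp add: wedge_def algebra_simps)
  have "Px ?u * fst ?v + Py ?u * snd ?v = phi t * (fst ?u * Px ?u + snd ?u * Py ?u) + T ?u"
    by (simp add: T_def rot_def algebra_simps)
  then have "Px ?u * fst ?v + Py ?u * snd ?v = real k * phi t * f t + f' t"
    by (simp add: euler f_def f'_def)
  then show ?thesis using gradient_on_F[OF phi_mem[OF assms]] w by simp
qed

end

text \<open>An angle on the half plane around \<open>unit_vector t\<close>, by an explicit formula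
  that can be differentiated along a curve.\<close>

lemma polar_near:
  assumes "unit_vector t \<bullet> p > 0"
  shows "p = norm p *\<^sub>R unit_vector (t + arctan (wedge (unit_vector t) p / (unit_vector t \<bullet> p)))"
proof -
  let ?u = "unit_vector t"
  define a b where "a = ?u \<bullet> p" and "b = wedge ?u p"
  have a: "a > 0" using assms by (simp add: a_def)
  have p: "p = a *\<^sub>R ?u + b *\<^sub>R rot ?u" unfolding a_def b_def by (rule plane_frame)
  have "p \<bullet> p = a\<^sup>2 + b\<^sup>2"
  proof -
    have "?u \<bullet> ?u = 1" by (simp add: dot_square_norm)
    moreover have "rot ?u \<bullet> rot ?u = ?u \<bullet> ?u" "?u \<bullet> rot ?u = 0" "rot ?u \<bullet> ?u = 0"
      by (simp_all add: rot_def inner_prod_def)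
    ultimately show ?thesis
      unfolding p by (simp add: inner_add_left inner_add_right power2_eq_square)
  qed
  then have n: "norm p = sqrt (a\<^sup>2 + b\<^sup>2)" by (simp add: norm_eq_sqrt_inner)
  have u: "unit_vector (t + s) = cos s *\<^sub>R ?u + sin s *\<^sub>R rot ?u" for s
    by (simp add: unit_vector_def rot_def cos_add sin_add)
  have "sqrt (1 + (b / a)\<^sup>2) = norm p / a"
  proof -
    have "1 + (b / a)\<^sup>2 = (a\<^sup>2 + b\<^sup>2) / a\<^sup>2" using a by (simp add: power_divide add_divide_distrib)
    then show ?thesis using a n by (simp add: real_sqrt_divide)
  qed
  moreover have "norm p > 0" using a unfolding n by (simp add: sum_power2_gt_zero_iff)
  ultimately have "norm p * cos (arctan (b / a)) = a" "norm p * sin (arctan (b / a)) = b"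
    using a by (simp_all add: cos_arctan sin_arctan field_simps)
  then show ?thesis
    unfolding u a_def[symmetric] b_def[symmetric] scaleR_add_right scaleR_scaleR
    using p by simp
qed

lemma filterlim_at_top_of_exp_bound:
  fixes h g :: "real \<Rightarrow> real"
  assumes "m > 0" "k > 0" "(g \<longlongrightarrow> 0) G" "eventually (\<lambda>t. m \<le> exp (k * h t) * \<bar>g t\<bar>) G"
  shows "filterlim h at_top G"
  unfolding filterlim_at_top
proof
  fix Z
  have "eventually (\<lambda>t. \<bar>g t\<bar> < m / exp (k * Z)) G"
    using assms(1) tendstoD[OF assms(3), of "m / exp (k * Z)"] by simp
  then show "eventually (\<lambda>t. Z \<le> h t) G"
    using assms(4)
  proof eventually_elim
    case (elim t)
    have "\<bar>g t\<bar> * exp (k * Z) < exp (k * h t) * \<bar>g t\<bar>" using elim by (simp add: field_simps)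
    then have "exp (k * Z) < exp (k * h t)" by (metis abs_ge_zero mult.commute mult_less_cancel_left_disj not_less)
    then show ?case using assms(2) by simp
  qed
qed

text \<open>A sector free of radial angles between two radial ones, with an antiderivative of
  \<open>phi\<close>. The latter is determined up to a constant, which becomes the parameter
  \<open>c\<close> of the homothetic curves below.\<close>

locale saddle_sector = saddle_form +
  fixes \<alpha> \<beta> :: real and \<Phi> :: "real \<Rightarrow> real"
  assumes \<alpha>_less_\<beta>: "\<alpha> < \<beta>" and radial_\<alpha>: "radial \<alpha>" and radial_\<beta>: "radial \<beta>"
    and not_radial: "\<And>t. \<alpha> < t \<Longrightarrow> t < \<beta> \<Longrightarrow> \<not> radial t"
    and \<Phi>_derivative: "\<And>t. \<alpha> < t \<Longrightarrow> t < \<beta> \<Longrightarrow> (\<Phi> has_real_derivative phi t) (at t)"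
begin

definition \<gamma> :: "real \<Rightarrow> real \<Rightarrow> real \<times> real" where
  "\<gamma> c t = exp (c + \<Phi> t) *\<^sub>R unit_vector t"

lemma \<gamma>_nonzero [simp]: "\<gamma> c t \<noteq> 0"
  by (simp add: \<gamma>_def)

lemma norm_\<gamma>: "norm (\<gamma> c t) = exp (c + \<Phi> t)"
  by (simp add: \<gamma>_def)

lemma F_\<gamma>: "F (\<gamma> c t) = F (unit_vector t)"
  by (simp add: \<gamma>_def F_homogeneous)

lemma isCont_\<Phi>: "\<alpha> < t \<Longrightarrow> t < \<beta> \<Longrightarrow> isCont \<Phi> t"
  using \<Phi>_derivative DERIV_isCont by blast

lemma continuous_on_\<Phi>: "continuous_on {\<alpha><..<\<beta>} \<Phi>"
  by (intro continuous_at_imp_continuous_on) (simp add: isCont_\<Phi>)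

lemma \<gamma>_derivative:
  assumes "\<alpha> < t" "t < \<beta>"
  shows "(\<gamma> c has_vector_derivative exp (c + \<Phi> t) *\<^sub>R (phi t *\<^sub>R unit_vector t + rot (unit_vector t))) (at t)"
proof -
  have "((\<lambda>t. exp (c + \<Phi> t)) has_real_derivative exp (c + \<Phi> t) * phi t) (at t)"
    using \<Phi>_derivative[OF assms] by (auto intro!: derivative_eq_intros)
  from has_vector_derivative_scaleR[OF this unit_vector_derivative]
  show ?thesis unfolding \<gamma>_def[abs_def]
    by (rule has_vector_derivative_eq_rhs) (simp add: algebra_simps)
qed

lemma integral_curve_\<gamma>: "integral_curve F {\<alpha><..<\<beta>} (\<gamma> c)"
  unfolding integral_curve_def
proof (intro conjI exI ballI)
  show "continuous_on {\<alpha><..<\<beta>} (\<lambda>t. exp (c + \<Phi> t) *\<^sub>R (phi t *\<^sub>R unit_vector t + rot (unit_vector t)))"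
    using isCont_phi not_radial
    by (intro continuous_intros continuous_on_\<Phi> continuous_at_imp_continuous_on) auto
  fix t assume "t \<in> {\<alpha><..<\<beta>}"
  then have t: "\<alpha> < t" "t < \<beta>" by auto
  let ?v = "phi t *\<^sub>R unit_vector t + rot (unit_vector t)"
  show "(\<gamma> c has_vector_derivative exp (c + \<Phi> t) *\<^sub>R ?v) (at t)" using t by (rule \<gamma>_derivative)
  show "exp (c + \<Phi> t) *\<^sub>R ?v \<in> F (\<gamma> c t)"
    unfolding F_\<gamma> using t by (intro F_scaleR phi_mem not_radial)
  have "wedge (unit_vector t) ?v = 1"
    using wedge_unit_rot[of t] by (simp add: wedge_def algebra_simps)
  then have "?v \<noteq> 0" by (metis diff_self fst_zero mult_zero_right snd_zero wedge_def zero_neq_one)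
  then show "exp (c + \<Phi> t) *\<^sub>R ?v \<noteq> 0" by simp
qed (use \<alpha>_less_\<beta> in auto)

lemma P_\<gamma>: "P (\<gamma> c t) = exp (real k * (c + \<Phi> t)) * f t"
  by (simp add: \<gamma>_def P_homogeneous f_def exp_of_nat_mult)

lemma P_\<gamma>_strict_mono:
  assumes "\<alpha> < s" "s < t" "t < \<beta>"
  shows "P (\<gamma> c s) < P (\<gamma> c t)"
proof (rule DERIV_pos_imp_increasing[of s t "\<lambda>t. P (\<gamma> c t)"])
  fix x assume "s \<le> x" "x \<le> t"
  then have x: "\<alpha> < x" "x < \<beta>" using assms by auto
  have "((\<lambda>t. exp (real k * (c + \<Phi> t)) * f t) has_real_derivative
      exp (real k * (c + \<Phi> x)) * (real k * phi x * f x + f' x)) (at x)"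
    by (auto intro!: derivative_eq_intros f_derivative \<Phi>_derivative x simp: algebra_simps)
  moreover have "real k * phi x * f x + f' x > 0"
    using phi_f[OF not_radial[OF x]] S_pos[of "unit_vector x"] k_pos
    by (metis unit_vector_nz zero_less_mult_pos)
  ultimately show "\<exists>y. ((\<lambda>t. P (\<gamma> c t)) has_real_derivative y) (at x) \<and> 0 < y"
    unfolding P_\<gamma> by (metis exp_gt_zero mult_pos_pos)
qed (use assms in auto)

text \<open>Both ends are zeros with \<open>f' < 0\<close>, so \<open>f\<close> is negative just
  after \<open>\<alpha>\<close> and, in the companion lemma, positive just before
  \<open>\<beta>\<close>. The slot \<open>Q\<close> lets the same threshold serve a further local
  condition.\<close>

lemma f_near_\<alpha>:
  assumes "eventually Q (at_right \<alpha>)"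
  obtains d where "\<alpha> < d" "d < \<beta>" "\<And>t. \<alpha> < t \<Longrightarrow> t \<le> d \<Longrightarrow> f t < 0 \<and> f' t < 0 \<and> Q t"
proof -
  have "isCont f' \<alpha>" using continuous_on_f'[OF continuous_on_id, of UNIV]
    by (simp add: continuous_on_eq_continuous_at)
  then have "eventually (\<lambda>t. f' t < 0) (at_right \<alpha>)"
    using radial_\<alpha> by (intro order_tendstoD(2)) (auto simp: radial_iff_f continuous_at_imp_continuous_at_within isCont_def intro: filterlim_mono[OF _ order_refl at_le])
  then have "eventually (\<lambda>t. f' t < 0 \<and> Q t) (at_right \<alpha>)" using assms eventually_conj by blast
  then obtain b where b: "b > \<alpha>" "\<And>t. \<alpha> < t \<Longrightarrow> t < b \<Longrightarrow> f' t < 0 \<and> Q t"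
    unfolding eventually_at_right_field by blast
  define d where "d = (\<alpha> + min b \<beta>) / 2"
  have d: "\<alpha> < d" "d < b" "d < \<beta>" using b(1) \<alpha>_less_\<beta> by (auto simp: d_def min_def)
  have "f t < 0" if t: "\<alpha> < t" "t \<le> d" for t
  proof -
    have "f t < f \<alpha>"
    proof (rule DERIV_neg_imp_decreasing[OF t(1)])
      fix x assume "\<alpha> \<le> x" "x \<le> t"
      then have "f' x < 0" using b(2)[of x] radial_\<alpha> t d by (cases "x = \<alpha>") (auto simp: radial_iff_f)
      then show "\<exists>y. (f has_real_derivative y) (at x) \<and> y < 0" using f_derivative by blast
    qed
    then show ?thesis using radial_\<alpha> by (simp add: radial_iff_f)
  qed
  then show ?thesis using that[of d] d b(2) by force
qed

lemma f_near_\<beta>: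
  assumes "eventually Q (at_left \<beta>)"
  obtains d where "\<alpha> < d" "d < \<beta>" "\<And>t. d \<le> t \<Longrightarrow> t < \<beta> \<Longrightarrow> f t > 0 \<and> f' t < 0 \<and> Q t"
proof -
  have "isCont f' \<beta>" using continuous_on_f'[OF continuous_on_id, of UNIV]
    by (simp add: continuous_on_eq_continuous_at)
  then have "eventually (\<lambda>t. f' t < 0) (at_left \<beta>)"
    using radial_\<beta> by (intro order_tendstoD(2)) (auto simp: radial_iff_f continuous_at_imp_continuous_at_within isCont_def intro: filterlim_mono[OF _ order_refl at_le])
  then have "eventually (\<lambda>t. f' t < 0 \<and> Q t) (at_left \<beta>)" using assms eventually_conj by blast
  then obtain b where b: "b < \<beta>" "\<And>t. b < t \<Longrightarrow> t < \<beta> \<Longrightarrow> f' t < 0 \<and> Q t"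
    unfolding eventually_at_left_field by blast
  define d where "d = (\<beta> + max b \<alpha>) / 2"
  have d: "\<alpha> < d" "b < d" "d < \<beta>" using b(1) \<alpha>_less_\<beta> by (auto simp: d_def max_def)
  have "f t > 0" if t: "d \<le> t" "t < \<beta>" for t
  proof -
    have "f \<beta> < f t"
    proof (rule DERIV_neg_imp_decreasing[OF t(2)])
      fix x assume "t \<le> x" "x \<le> \<beta>"
      then have "f' x < 0" using b(2)[of x] radial_\<beta> t d by (cases "x = \<beta>") (auto simp: radial_iff_f)
      then show "\<exists>y. (f has_real_derivative y) (at x) \<and> y < 0" using f_derivative by blast
    qed
    then show ?thesis using radial_\<beta> by (simp add: radial_iff_f)
  qed
  then show ?thesis using that[of d] d b(2) by force
qed

lemma f_tendsto_0: "(f \<longlongrightarrow> 0) (at_right \<alpha>)" "(f \<longlongrightarrow> 0) (at_left \<beta>)"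
proof -
  have "isCont f t" for t using f_derivative DERIV_isCont by blast
  then have "(f \<longlongrightarrow> f t) (at t within X)" for t X
    by (metis continuous_at_imp_continuous_at_within continuous_within)
  then show "(f \<longlongrightarrow> 0) (at_right \<alpha>)" "(f \<longlongrightarrow> 0) (at_left \<beta>)"
    using radial_\<alpha> radial_\<beta> by (metis radial_iff_f)+
qed

text \<open>Along an integral curve \<open>P = r\<^sup>k f\<close> is increasing, so it stays away from \<open>0\<close> near the ends,
  whereas \<open>f\<close> tends to \<open>0\<close> there.\<close>

lemma \<Phi>_blowup: "filterlim \<Phi> at_top (at_right \<alpha>)" "filterlim \<Phi> at_top (at_left \<beta>)"
proof -
  obtain d where d: "\<alpha> < d" "d < \<beta>" "\<And>t. \<alpha> < t \<Longrightarrow> t \<le> d \<Longrightarrow> f t < 0 \<and> f' t < 0 \<and> True"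
    using f_near_\<alpha>[of "\<lambda>_. True"] by auto
  have "- P (\<gamma> 0 d) \<le> exp (real k * \<Phi> t) * \<bar>f t\<bar>" if "\<alpha> < t" "t < d" for t
    using P_\<gamma>_strict_mono[of t d 0] d that by (auto simp: P_\<gamma> abs_if)
  moreover have "- P (\<gamma> 0 d) > 0" using d by (simp add: P_\<gamma> mult_less_0_iff)
  ultimately show "filterlim \<Phi> at_top (at_right \<alpha>)"
    using d(1) k_pos f_tendsto_0(1)
    by (intro filterlim_at_top_of_exp_bound) (auto simp: eventually_at_right_field)
  obtain e where e: "\<alpha> < e" "e < \<beta>" "\<And>t. e \<le> t \<Longrightarrow> t < \<beta> \<Longrightarrow> f t > 0 \<and> f' t < 0 \<and> True"
    using f_near_\<beta>[of "\<lambda>_. True"] by auto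
  have "P (\<gamma> 0 e) \<le> exp (real k * \<Phi> t) * \<bar>f t\<bar>" if "e < t" "t < \<beta>" for t
    using P_\<gamma>_strict_mono[of e t 0] e(1) e(3)[of t] that by (auto simp: P_\<gamma>)
  moreover have "P (\<gamma> 0 e) > 0" using e by (simp add: P_\<gamma>)
  ultimately show "filterlim \<Phi> at_top (at_left \<beta>)"
    using e(2) k_pos f_tendsto_0(2)
    by (intro filterlim_at_top_of_exp_bound[where m = "P (\<gamma> 0 e)" and k = "real k"]) (auto simp: eventually_at_left_field)
qed

lemma norm_\<gamma>_blowup:
  "filterlim (\<lambda>t. norm (\<gamma> c t)) at_top (at_right \<alpha>)" "filterlim (\<lambda>t. norm (\<gamma> c t)) at_top (at_left \<beta>)"
  unfolding norm_\<gamma>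
  by (rule filterlim_compose[OF exp_at_top filterlim_tendsto_add_at_top[OF tendsto_const]], rule \<Phi>_blowup)+

text \<open>A convergent sequence of points on the curve is bounded, so its parameters cannot
  accumulate at \<open>\<alpha>\<close> or \<open>\<beta>\<close>. Closedness serves twice: to
  propagate uniqueness along a curve and to tell these lines from rays.\<close>

lemma closed_\<gamma>: "closed (\<gamma> c ` {\<alpha><..<\<beta>})"
  unfolding closed_sequential_limits
proof (intro allI impI, elim conjE)
  fix x l assume x: "\<forall>n. x n \<in> \<gamma> c ` {\<alpha><..<\<beta>}" and l: "x \<longlonglongrightarrow> l"
  from x have "\<forall>n. \<exists>s. x n = \<gamma> c s \<and> \<alpha> < s \<and> s < \<beta>" by (auto simp: image_iff Bex_def)
  then obtain s where s: "\<And>n. x n = \<gamma> c (s n)" "\<And>n. \<alpha> < s n" "\<And>n. s n < \<beta>" by metis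
  have s_ne: "s n \<noteq> \<alpha>" "s n \<noteq> \<beta>" for n using s(2,3)[of n] by auto
  have "seq_compact {\<alpha>..\<beta>}" by (simp add: compact_imp_seq_compact)
  moreover have "\<forall>n. s n \<in> {\<alpha>..\<beta>}" using s by (simp add: less_imp_le)
  ultimately obtain r \<tau> where r: "strict_mono r" "\<tau> \<in> {\<alpha>..\<beta>}" "(s \<circ> r) \<longlonglongrightarrow> \<tau>"
    unfolding seq_compact_def by blast
  have lr: "(\<lambda>n. \<gamma> c ((s \<circ> r) n)) \<longlonglongrightarrow> l"
    using LIMSEQ_subseq_LIMSEQ[OF l r(1)] s(1) by (simp add: o_def)
  have no: "\<not> filterlim (\<lambda>n. norm (\<gamma> c ((s \<circ> r) n))) at_top sequentially"
    using tendsto_norm[OF lr] filterlim_at_top_imp_at_infinity not_tendsto_and_filterlim_at_infinity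
      sequentially_bot by blast
  have "\<tau> \<noteq> \<alpha>"
  proof
    assume "\<tau> = \<alpha>"
    then have "filterlim (s \<circ> r) (at_right \<alpha>) sequentially"
      using r(3) s s_ne by (auto simp: filterlim_at)
    then show False using no filterlim_compose[OF norm_\<gamma>_blowup(1)] by blast
  qed
  moreover have "\<tau> \<noteq> \<beta>"
  proof
    assume "\<tau> = \<beta>"
    then have "filterlim (s \<circ> r) (at_left \<beta>) sequentially"
      using r(3) s s_ne by (auto simp: filterlim_at)
    then show False using no filterlim_compose[OF norm_\<gamma>_blowup(2)] by blast
  qed
  ultimately have \<tau>: "\<alpha> < \<tau>" "\<tau> < \<beta>" using r(2) by auto
  have "isCont (\<gamma> c) \<tau>" using \<gamma>_derivative[OF \<tau>] has_vector_derivative_continuous by blast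
  then have "(\<lambda>n. \<gamma> c ((s \<circ> r) n)) \<longlonglongrightarrow> \<gamma> c \<tau>" using r(3) isCont_tendsto_compose by blast
  then have "l = \<gamma> c \<tau>" using lr LIMSEQ_unique by blast
  then show "l \<in> \<gamma> c ` {\<alpha><..<\<beta>}" using \<tau> by auto
qed

text \<open>In polar coordinates along \<open>\<delta>\<close>, the logarithmic derivative of the
  radius is \<open>phi\<close> times the derivative of the angle, so the first integral is locally
  constant, with value \<open>c\<close>. This works for every parametrisation, without passing to
  the angle as parameter.\<close>

lemma local_uniqueness:
  assumes \<delta>: "integral_curve F J \<delta>" and t0: "t0 \<in> J" and \<tau>0: "\<alpha> < \<tau>0" "\<tau>0 < \<beta>"
    and eq: "\<delta> t0 = \<gamma> c \<tau>0"
  shows "\<exists>e>0. \<forall>t\<in>J. dist t t0 < e \<longrightarrow> \<delta> t \<in> \<gamma> c ` {\<alpha><..<\<beta>}"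
proof -
  obtain \<delta>' where J: "open J" and d: "\<And>t. t \<in> J \<Longrightarrow> (\<delta> has_vector_derivative \<delta>' t) (at t)"
      and dF: "\<And>t. t \<in> J \<Longrightarrow> \<delta>' t \<in> F (\<delta> t)"
    using \<delta> unfolding integral_curve_def by blast
  let ?u = "unit_vector \<tau>0"
  define \<psi> where "\<psi> t = \<tau>0 + arctan (wedge ?u (\<delta> t) / (?u \<bullet> \<delta> t))" for t
  define U where "U t = unit_vector (\<psi> t)" for t
  \<comment> \<open>Equal to \<open>norm (\<delta> t)\<close> near \<open>t0\<close>; as an inner
    product it is differentiated by the product rule.\<close>
  define \<rho> where "\<rho> t = U t \<bullet> \<delta> t" for t
  have u\<delta>0: "?u \<bullet> \<delta> t0 > 0" "wedge ?u (\<delta> t0) = 0"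
    by (simp_all add: eq \<gamma>_def dot_square_norm wedge_def)
  have \<psi>0: "\<psi> t0 = \<tau>0" by (simp add: \<psi>_def u\<delta>0)
  have c\<delta>: "isCont \<delta> t0" using d[OF t0] has_vector_derivative_continuous by blast
  have c\<psi>: "isCont \<psi> t0"
    unfolding \<psi>_def wedge_def using c\<delta> u\<delta>0 by (intro continuous_intros) auto
  have ci: "isCont (\<lambda>t. ?u \<bullet> \<delta> t) t0" using c\<delta> by (intro continuous_intros)
  have "eventually (\<lambda>t. ?u \<bullet> \<delta> t > 0) (nhds t0)"
    using ci u\<delta>0(1) tendsto_at_iff_tendsto_nhds[of "\<lambda>t. ?u \<bullet> \<delta> t" t0]
    by (auto simp: isCont_def intro: order_tendstoD)
  moreover have "eventually (\<lambda>t. \<psi> t > \<alpha>) (nhds t0)" "eventually (\<lambda>t. \<psi> t < \<beta>) (nhds t0)"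
    using c\<psi> \<psi>0 \<tau>0 unfolding isCont_def tendsto_at_iff_tendsto_nhds by (auto intro: order_tendstoD)
  moreover have "eventually (\<lambda>t. t \<in> J) (nhds t0)" using J t0 by (rule eventually_nhds_in_open)
  ultimately have "eventually (\<lambda>t. ?u \<bullet> \<delta> t > 0 \<and> \<psi> t > \<alpha> \<and> \<psi> t < \<beta> \<and> t \<in> J) (nhds t0)"
    by eventually_elim simp
  then obtain e where e: "e > 0" and near: "\<And>t. dist t t0 < e \<Longrightarrow> ?u \<bullet> \<delta> t > 0 \<and> \<psi> t > \<alpha> \<and> \<psi> t < \<beta> \<and> t \<in> J"
    unfolding eventually_nhds_metric by blast
  define I where "I = ball t0 e"
  have I: "?u \<bullet> \<delta> t > 0" "\<psi> t > \<alpha>" "\<psi> t < \<beta>" "t \<in> J" if "t \<in> I" for t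
    using near[of t] that by (auto simp: I_def dist_commute)
  have \<rho>: "\<delta> t = \<rho> t *\<^sub>R U t" "\<rho> t > 0" if "t \<in> I" for t
  proof -
    have *: "\<delta> t = norm (\<delta> t) *\<^sub>R U t" using polar_near[OF I(1)[OF that]] by (simp add: U_def \<psi>_def)
    have "U t \<bullet> U t = 1" by (simp add: U_def dot_square_norm)
    then have r: "\<rho> t = norm (\<delta> t)" unfolding \<rho>_def by (subst *) simp
    then show "\<delta> t = \<rho> t *\<^sub>R U t" using * by simp
    show "\<rho> t > 0" using r I(1)[OF that] by auto
  qed
  have "((\<lambda>t. ln (\<rho> t) - \<Phi> (\<psi> t)) has_real_derivative 0) (at t)" if t: "t \<in> I" for t
  proof -
    note d = d[OF I(4)[OF t]]
    have b1: "bounded_linear (wedge ?u)"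
      unfolding wedge_def[abs_def] by (intro bounded_linear_intros)
    have D1: "((\<lambda>t. wedge ?u (\<delta> t)) has_real_derivative wedge ?u (\<delta>' t)) (at t)"
      unfolding has_real_derivative_iff_has_vector_derivative by (rule bounded_linear.has_vector_derivative[OF b1 d])
    have D2: "((\<lambda>t. ?u \<bullet> \<delta> t) has_real_derivative ?u \<bullet> \<delta>' t) (at t)"
      unfolding has_real_derivative_iff_has_vector_derivative
      by (rule bounded_linear.has_vector_derivative[OF bounded_linear_inner_right d])
    obtain \<psi>' where \<psi>': "(\<psi> has_real_derivative \<psi>') (at t)"
      using DERIV_add[OF DERIV_const DERIV_chain2[OF DERIV_arctan DERIV_divide[OF D1 D2]], of \<tau>0] I(1)[OF t]
      unfolding \<psi>_def[abs_def] by auto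
    have dU: "(U has_vector_derivative \<psi>' *\<^sub>R rot (U t)) (at t)"
      using vector_diff_chain_at[OF \<psi>'[unfolded has_real_derivative_iff_has_vector_derivative] unit_vector_derivative]
      by (simp add: U_def[abs_def] o_def)
    have rw: "rot x \<bullet> y = wedge x y" "wedge (rot x) y = - (x \<bullet> y)" for x y
      by (simp_all add: rot_def wedge_def inner_prod_def)
    have wz: "wedge (U s) (\<delta> s) = 0" if "s \<in> I" for s
    proof -
      have "wedge (U s) (r *\<^sub>R U s) = 0" for r by (simp add: wedge_def)
      then show ?thesis using \<rho>(1)[OF that] by metis
    qed
    have d\<rho>: "(\<rho> has_real_derivative U t \<bullet> \<delta>' t) (at t)"
      using bounded_bilinear.has_vector_derivative[OF bounded_bilinear_inner dU d] wz[OF t]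
      by (simp add: \<rho>_def[abs_def] has_real_derivative_iff_has_vector_derivative rw)
    have b2: "bounded_bilinear wedge"
    proof -
      have "bounded_bilinear (\<lambda>x y. rot x \<bullet> y)"
        using bounded_bilinear.comp1[OF bounded_bilinear_inner, of rot]
        by (simp add: rot_def[abs_def] bounded_linear_Pair bounded_linear_minus bounded_linear_fst bounded_linear_snd)
      then show ?thesis by (simp add: rw)
    qed
    \<comment> \<open>\<open>\<delta>\<close> is a multiple of \<open>U\<close>, so this wedge
      vanishes identically on \<open>I\<close>; comparing with its derivative by the product rule
      gives the angular velocity.\<close>
    have "((\<lambda>s. wedge (U s) (\<delta> s)) has_real_derivative wedge (U t) (\<delta>' t) - \<psi>' * \<rho> t) (at t)"
      using bounded_bilinear.has_vector_derivative[OF b2 dU d] wz[OF t]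
      by (simp add: has_real_derivative_iff_has_vector_derivative rw \<rho>_def bounded_bilinear.scaleR_left[OF b2])
    moreover have "((\<lambda>s. wedge (U s) (\<delta> s)) has_real_derivative 0) (at t)"
      by (rule has_field_derivative_transform_within_open[OF DERIV_const[of 0], where S = I])
        (use t wz in \<open>auto simp: I_def\<close>)
    ultimately have "wedge (U t) (\<delta>' t) = \<psi>' * \<rho> t" using DERIV_unique by fastforce
    moreover have "\<delta>' t \<in> F (unit_vector (\<psi> t))"
      using dF[OF I(4)[OF t]] \<rho>[OF t] F_homogeneous by (metis U_def)
    ultimately have "U t \<bullet> \<delta>' t = phi (\<psi> t) * (\<psi>' * \<rho> t)"
      using phi_slope[OF not_radial[OF I(2,3)[OF t]]] by (simp add: U_def)
    moreover have "((\<lambda>t. ln (\<rho> t) - \<Phi> (\<psi> t)) has_real_derivative 1 / \<rho> t * (U t \<bullet> \<delta>' t) - phi (\<psi> t) * \<psi>') (at t)"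
      by (intro DERIV_diff DERIV_chain2[OF DERIV_ln_divide d\<rho>] DERIV_chain2[OF \<Phi>_derivative \<psi>'] \<rho> I t)
    ultimately show ?thesis using \<rho>(2)[OF t] by simp
  qed
  then have "\<exists>l. \<forall>t\<in>I. ln (\<rho> t) - \<Phi> (\<psi> t) = l"
    by (intro has_field_derivative_zero_constant) (auto simp: I_def intro: has_field_derivative_at_within)
  moreover have t0I: "t0 \<in> I" using e by (simp add: I_def)
  moreover have "\<rho> t0 = exp (c + \<Phi> \<tau>0)" by (simp add: \<rho>_def U_def \<psi>0 eq \<gamma>_def dot_square_norm)
  ultimately have c: "ln (\<rho> t) - \<Phi> (\<psi> t) = c" if "t \<in> I" for t
    using that \<psi>0 by fastforce
  have "\<delta> t \<in> \<gamma> c ` {\<alpha><..<\<beta>}" if "t \<in> I" for t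
  proof -
    have "\<rho> t = exp (ln (\<rho> t))" using \<rho>(2)[OF that] by simp
    also have "ln (\<rho> t) = c + \<Phi> (\<psi> t)" using c[OF that] by simp
    finally have "\<delta> t = \<gamma> c (\<psi> t)" using \<rho>(1)[OF that] by (simp add: \<gamma>_def U_def)
    then show ?thesis using I(2,3)[OF that] by auto
  qed
  then show ?thesis using e by (auto simp: I_def dist_commute)
qed

text \<open>The parameters sent into the curve form an open subset of \<open>J\<close> by
  \<open>local_uniqueness\<close> and a closed one because the curve is closed; \<open>J\<close> is
  connected.\<close>

lemma integral_curve_subset_\<gamma>:
  assumes \<delta>: "integral_curve F J \<delta>" and meets: "\<delta> ` J \<inter> \<gamma> c ` {\<alpha><..<\<beta>} \<noteq> {}"
  shows "\<delta> ` J \<subseteq> \<gamma> c ` {\<alpha><..<\<beta>}"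
proof -
  let ?C = "\<gamma> c ` {\<alpha><..<\<beta>}"
  have J: "connected J"
    using \<delta> by (simp add: integral_curve_def is_interval_connected_1)
  have c: "continuous_on J \<delta>"
    using \<delta> has_vector_derivative_continuous unfolding integral_curve_def
    by (intro continuous_at_imp_continuous_on) blast
  have "openin (top_of_set J) {t \<in> J. \<delta> t \<in> ?C}"
    unfolding openin_euclidean_subtopology_iff
  proof (intro conjI ballI)
    fix t0 assume "t0 \<in> {t \<in> J. \<delta> t \<in> ?C}"
    then obtain \<tau>0 where "t0 \<in> J" "\<alpha> < \<tau>0" "\<tau>0 < \<beta>" "\<delta> t0 = \<gamma> c \<tau>0" by auto
    from local_uniqueness[OF \<delta> this]
    show "\<exists>e>0. \<forall>t\<in>J. dist t t0 < e \<longrightarrow> t \<in> {t \<in> J. \<delta> t \<in> ?C}" by fast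
  qed auto
  moreover have "closedin (top_of_set J) (J \<inter> \<delta> -` ?C)"
    using c closed_\<gamma> by (rule continuous_closedin_preimage)
  moreover have "J \<inter> \<delta> -` ?C = {t \<in> J. \<delta> t \<in> ?C}" by auto
  ultimately have "{t \<in> J. \<delta> t \<in> ?C} = {} \<or> {t \<in> J. \<delta> t \<in> ?C} = J"
    using J unfolding connected_clopen by metis
  then show ?thesis using meets by blast
qed

lemma asymptotic_line_\<gamma>: "asymptotic_line F (\<gamma> c ` {\<alpha><..<\<beta>})"
  unfolding asymptotic_line_def using integral_curve_\<gamma> integral_curve_subset_\<gamma> by blast

lemma traverses_sector_\<gamma>: "traverses_sector F \<alpha> \<beta> \<alpha> \<beta> (\<gamma> c)"
proof -
  have n: "\<gamma> c t /\<^sub>R norm (\<gamma> c t) = unit_vector t" for t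
    unfolding norm_\<gamma> by (simp add: \<gamma>_def)
  have "(unit_vector \<longlongrightarrow> unit_vector t) (at t within X)" for t X
    by (metis continuous_at_imp_continuous_at_within continuous_within isCont_unit_vector)
  moreover have "\<gamma> c ` {\<alpha><..<\<beta>} \<subseteq> sector \<alpha> \<beta>"
    by (intro image_subsetI) (unfold sector_def \<gamma>_def greaterThanLessThan_iff, use exp_gt_zero in blast)
  ultimately show ?thesis
    unfolding traverses_sector_def n
    using \<alpha>_less_\<beta> integral_curve_\<gamma> asymptotic_line_\<gamma> norm_\<gamma>_blowup by blast
qed

lemma through_point:
  assumes "r > 0"
  shows "r *\<^sub>R unit_vector t = \<gamma> (ln r - \<Phi> t) t"
  using assms by (simp add: \<gamma>_def)

text \<open>In \<open>phi_f\<close> the sum is positive while its term \<open>f' t\<close> is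
  negative, so \<open>phi t * f t > 0\<close>. Near both ends the radius is thus monotone in the
  angle.\<close>

lemma \<Phi>_derivative_sign:
  assumes "\<alpha> < t" "t < \<beta>" "f' t < 0"
  shows "f t < 0 \<Longrightarrow> phi t < 0" "f t > 0 \<Longrightarrow> phi t > 0"
proof -
  have "real k * phi t * f t + f' t > 0"
    using phi_f[OF not_radial[OF assms(1,2)]] S_pos[of "unit_vector t"] k_pos
    by (metis unit_vector_nz zero_less_mult_pos)
  then have "phi t * f t > 0" using assms(3) k_pos
    by (metis add.commute add_less_same_cancel2 dual_order.strict_trans mult.assoc zero_less_mult_pos)
  then show "f t < 0 \<Longrightarrow> phi t < 0" "f t > 0 \<Longrightarrow> phi t > 0" by (simp_all add: zero_less_mult_iff)
qed

text \<open>Up to an angle \<open>d\<close> and from an angle \<open>e\<close> on, the radius is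
  monotone and the directions are close to the bounding rays. A curve that comes close enough to the
  origin is inside the disc at all angles in between, so it crosses the circle of radius
  \<open>\<rho>\<close> in the two end ranges.\<close>

lemma passage_near_origin:
  assumes "\<rho> > 0" "\<eta> > 0"
  shows "\<exists>\<delta>>0. \<forall>q \<in> sector \<alpha> \<beta> \<inter> ball 0 \<delta>.
        \<exists>a b \<gamma> s u. traverses_sector F \<alpha> \<beta> a b \<gamma> \<and> a < s \<and> s < u \<and> u < b \<and>
          q \<in> \<gamma> ` {s<..<u} \<and> \<gamma> ` {s<..<u} \<subseteq> ball 0 \<rho> \<and>
          norm (\<gamma> s) = \<rho> \<and> dist (\<gamma> s) (\<rho> *\<^sub>R unit_vector \<alpha>) < \<eta> \<and>
          norm (\<gamma> u) = \<rho> \<and> dist (\<gamma> u) (\<rho> *\<^sub>R unit_vector \<beta>) < \<eta>"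
proof -
  have lim: "(unit_vector \<longlongrightarrow> unit_vector t) (at t within X)" for t X
    by (metis continuous_at_imp_continuous_at_within continuous_within isCont_unit_vector)
  have "\<eta> / \<rho> > 0" using assms by simp
  obtain d where d: "\<alpha> < d" "d < \<beta>"
      "\<And>t. \<alpha> < t \<Longrightarrow> t \<le> d \<Longrightarrow> f t < 0 \<and> f' t < 0 \<and> dist (unit_vector t) (unit_vector \<alpha>) < \<eta> / \<rho>"
    using f_near_\<alpha>[OF tendstoD[OF lim \<open>\<eta> / \<rho> > 0\<close>]] by blast
  obtain e where e: "\<alpha> < e" "e < \<beta>"
      "\<And>t. e \<le> t \<Longrightarrow> t < \<beta> \<Longrightarrow> f t > 0 \<and> f' t < 0 \<and> dist (unit_vector t) (unit_vector \<beta>) < \<eta> / \<rho>"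
    using f_near_\<beta>[OF tendstoD[OF lim \<open>\<eta> / \<rho> > 0\<close>]] by blast
  have "d < e" using d(3)[of e] e(3)[of e] e(1,2) by fastforce
  have dec: "\<Phi> t < \<Phi> s" if "\<alpha> < s" "s < t" "t \<le> d" for s t
  proof (rule DERIV_neg_imp_decreasing[OF that(2)])
    fix x assume "s \<le> x" "x \<le> t"
    then have x: "\<alpha> < x" "x \<le> d" "x < \<beta>" using that d by auto
    then show "\<exists>y. (\<Phi> has_real_derivative y) (at x) \<and> y < 0"
      using \<Phi>_derivative[OF x(1,3)] \<Phi>_derivative_sign(1)[OF x(1,3)] d(3)[OF x(1,2)] by blast
  qed
  have inc: "\<Phi> s < \<Phi> t" if "e \<le> s" "s < t" "t < \<beta>" for s t
  proof (rule DERIV_pos_imp_increasing[OF that(2)])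
    fix x assume "s \<le> x" "x \<le> t"
    then have x: "e \<le> x" "x < \<beta>" "\<alpha> < x" using that e by auto
    then show "\<exists>y. (\<Phi> has_real_derivative y) (at x) \<and> y > 0"
      using \<Phi>_derivative[OF x(3,2)] \<Phi>_derivative_sign(2)[OF x(3,2)] e(3)[OF x(1,2)] by blast
  qed
  have "\<forall>x. d \<le> x \<and> x \<le> e \<longrightarrow> isCont \<Phi> x" using isCont_\<Phi> d e by auto
  then obtain m M where mM: "\<And>x. d \<le> x \<Longrightarrow> x \<le> e \<Longrightarrow> m \<le> \<Phi> x \<and> \<Phi> x \<le> M"
    using isCont_bounded[of d e \<Phi>] isCont_eq_Lb[of d e \<Phi>] isCont_eq_Ub[of d e \<Phi>] \<open>d < e\<close> by (metis less_imp_le)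
  \<comment> \<open>Outside the middle range \<open>\<Phi>\<close> is larger still, being monotone
    towards the ends, so \<open>m\<close> bounds it on the whole sector.\<close>
  have m: "m \<le> \<Phi> x" if "\<alpha> < x" "x < \<beta>" for x
    using mM[of x] mM[of d] mM[of e] dec[of x d] inc[of e x] that \<open>d < e\<close> by (smt (verit))
  have "m \<le> M" using mM[of d] \<open>d < e\<close> by simp
  show ?thesis
  \<comment> \<open>A curve through a point of radius \<open>r\<close> has
    \<open>c \<le> ln r - m\<close>, while \<open>\<Phi>\<close> is at most \<open>M\<close> between
    \<open>d\<close> and \<open>e\<close>; for \<open>r\<close> below this bound the radius there
    stays below \<open>\<rho>\<close>.\<close>
  proof (rule exI[of _ "\<rho> * exp (m - M)"], intro conjI ballI)
    show "\<rho> * exp (m - M) > 0" using assms by simp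
    fix q assume q: "q \<in> sector \<alpha> \<beta> \<inter> ball 0 (\<rho> * exp (m - M))"
    then obtain r t where rt: "q = r *\<^sub>R unit_vector t" "r > 0" "\<alpha> < t" "t < \<beta>" by (auto simp: sector_def)
    define c where "c = ln r - \<Phi> t"
    have "r < \<rho> * exp (m - M)" using q rt by simp
    then have "ln r < ln (\<rho> * exp (m - M))" using rt(2) assms by (simp add: ln_less_cancel_iff)
    also have "\<dots> = ln \<rho> + m - M" using assms by (simp add: ln_mult)
    finally have lr: "ln r < ln \<rho> + m - M" .
    have mid: "c + \<Phi> x < ln \<rho>" if "d \<le> x" "x \<le> e" for x
      using mM[OF that] m[OF rt(3,4)] lr by (simp add: c_def)
    have at_t: "c + \<Phi> t < ln \<rho>" using lr \<open>m \<le> M\<close> by (simp add: c_def)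
    obtain s where s: "\<alpha> < s" "s < t" "s < d" "c + \<Phi> s = ln \<rho>"
    proof -
      \<comment> \<open>At the smaller of \<open>d\<close> and \<open>t\<close> the curve is inside
        the disc, and towards \<open>\<alpha>\<close> its radius tends to infinity; the crossing in
        between precedes both \<open>d\<close> and the point \<open>q\<close>.\<close>
      define x1 where "x1 = min d t"
      have x1: "\<alpha> < x1" "x1 < \<beta>" "c + \<Phi> x1 < ln \<rho>"
        using d(1,2) rt mid[of d] at_t \<open>d < e\<close> by (auto simp: x1_def min_def)
      have "eventually (\<lambda>x. ln \<rho> - c \<le> \<Phi> x) (at_right \<alpha>)"
        using \<Phi>_blowup(1) unfolding filterlim_at_top by blast
      moreover have "eventually (\<lambda>x. x < x1) (at_right \<alpha>)"
        using x1(1) by (auto simp: eventually_at_right_field)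
      moreover have "eventually (\<lambda>x. \<alpha> < x) (at_right \<alpha>)" by (simp add: eventually_at_right_less)
      ultimately have "eventually (\<lambda>x. ln \<rho> - c \<le> \<Phi> x \<and> x < x1 \<and> \<alpha> < x) (at_right \<alpha>)"
        by eventually_elim simp
      then obtain x0 where x0: "ln \<rho> - c \<le> \<Phi> x0" "x0 < x1" "\<alpha> < x0"
        using eventually_happens'[OF trivial_limit_at_right_real] by blast
      obtain s where s: "x0 \<le> s" "s \<le> x1" "\<Phi> s = ln \<rho> - c"
        using IVT2[of \<Phi> x1 "ln \<rho> - c" x0] x0 x1 isCont_\<Phi> by force
      moreover have "s \<noteq> x1" using s(3) x1(3) by auto
      ultimately show ?thesis using that[of s] x0 by (auto simp: x1_def)
    qed
    obtain u where u: "t < u" "e < u" "u < \<beta>" "c + \<Phi> u = ln \<rho>"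
    proof -
      define x1 where "x1 = max e t"
      have x1: "\<alpha> < x1" "x1 < \<beta>" "c + \<Phi> x1 < ln \<rho>"
        using e(1,2) rt mid[of e] at_t \<open>d < e\<close> by (auto simp: x1_def max_def)
      have "eventually (\<lambda>x. ln \<rho> - c \<le> \<Phi> x) (at_left \<beta>)"
        using \<Phi>_blowup(2) unfolding filterlim_at_top by blast
      moreover have "eventually (\<lambda>x. x > x1) (at_left \<beta>)"
        using x1(2) by (auto simp: eventually_at_left_field)
      moreover have "eventually (\<lambda>x. x < \<beta>) (at_left \<beta>)" by (auto simp: eventually_at_left_field intro: exI[of _ "\<beta> - 1"])
      ultimately have "eventually (\<lambda>x. ln \<rho> - c \<le> \<Phi> x \<and> x > x1 \<and> x < \<beta>) (at_left \<beta>)"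
        by eventually_elim simp
      then obtain x0 where x0: "ln \<rho> - c \<le> \<Phi> x0" "x0 > x1" "x0 < \<beta>"
        using eventually_happens'[OF trivial_limit_at_left_real] by blast
      obtain s where s: "x1 \<le> s" "s \<le> x0" "\<Phi> s = ln \<rho> - c"
        using IVT[of \<Phi> x1 "ln \<rho> - c" x0] x0 x1 isCont_\<Phi> by force
      moreover have "s \<noteq> x1" using s(3) x1(3) by auto
      ultimately show ?thesis using that[of s] x0 by (auto simp: x1_def)
    qed
    have inside: "c + \<Phi> x < ln \<rho>" if "s < x" "x < u" for x
      using mid[of x] dec[of s x] inc[of x u] s u that by (cases "x \<le> d"; cases "e \<le> x") auto
    have n: "norm (\<gamma> c s) = \<rho>" "norm (\<gamma> c u) = \<rho>"
      unfolding norm_\<gamma> s(4) u(4) using assms by simp_all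
    have "dist (\<gamma> c x) (\<rho> *\<^sub>R v) = \<rho> * dist (unit_vector x) v" if "c + \<Phi> x = ln \<rho>" for x v
      using assms(1) unfolding \<gamma>_def that by (simp add: dist_norm flip: scaleR_diff_right)
    then have "dist (\<gamma> c s) (\<rho> *\<^sub>R unit_vector \<alpha>) < \<eta>" "dist (\<gamma> c u) (\<rho> *\<^sub>R unit_vector \<beta>) < \<eta>"
      using d(3)[of s] e(3)[of u] s u assms by (auto simp: field_simps)
    moreover have "q \<in> \<gamma> c ` {s<..<u}"
      using through_point[OF rt(2)] rt s u by (auto simp: c_def)
    moreover have "\<gamma> c ` {s<..<u} \<subseteq> ball 0 \<rho>"
    proof (rule image_subsetI)
      fix x assume "x \<in> {s<..<u}"
      then have "exp (c + \<Phi> x) < exp (ln \<rho>)" using inside by simp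
      then show "\<gamma> c x \<in> ball 0 \<rho>" using assms by (simp add: norm_\<gamma>)
    qed
    ultimately show "\<exists>a b \<gamma> s u. traverses_sector F \<alpha> \<beta> a b \<gamma> \<and> a < s \<and> s < u \<and> u < b \<and>
          q \<in> \<gamma> ` {s<..<u} \<and> \<gamma> ` {s<..<u} \<subseteq> ball 0 \<rho> \<and>
          norm (\<gamma> s) = \<rho> \<and> dist (\<gamma> s) (\<rho> *\<^sub>R unit_vector \<alpha>) < \<eta> \<and>
          norm (\<gamma> u) = \<rho> \<and> dist (\<gamma> u) (\<rho> *\<^sub>R unit_vector \<beta>) < \<eta>"
      using traverses_sector_\<gamma>[of c] n s u by (intro exI[of _ \<alpha>] exI[of _ \<beta>] exI[of _ "\<gamma> c"] exI[of _ s] exI[of _ u]) auto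
  qed
qed

end

subsection \<open>Counting the radial directions\<close>

lemma sgn_eq_if_no_zero:
  fixes g :: "real \<Rightarrow> real"
  assumes "a \<le> b" "\<And>t. isCont g t" "\<And>t. a \<le> t \<Longrightarrow> t \<le> b \<Longrightarrow> g t \<noteq> 0"
  shows "sgn (g a) = sgn (g b)"
proof (rule ccontr)
  assume ne: "sgn (g a) \<noteq> sgn (g b)"
  have "g a \<noteq> 0" "g b \<noteq> 0" using assms by auto
  with ne consider "g a < 0" "0 < g b" | "g b < 0" "0 < g a" by (auto simp: sgn_if split: if_splits)
  then show False
    by cases (use IVT[of g a 0 b] IVT2[of g b 0 a] assms in \<open>force simp: less_imp_le\<close>)+
qed

lemma sgn_near_simple_zero:
  fixes g :: "real \<Rightarrow> real"
  assumes "(g has_real_derivative l) (at z)" "g z = 0" "l \<noteq> 0"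
  obtains d where "d > 0" "\<And>h. 0 < h \<Longrightarrow> h < d \<Longrightarrow> sgn (g (z + h)) = sgn l \<and> sgn (g (z - h)) = - sgn l"
proof (cases "l > 0")
  case True
  obtain d1 d2 where "d1 > 0" "d2 > 0" "\<And>h. 0 < h \<Longrightarrow> h < d1 \<Longrightarrow> g z < g (z + h)"
      "\<And>h. 0 < h \<Longrightarrow> h < d2 \<Longrightarrow> g (z - h) < g z"
    using DERIV_pos_inc_right[OF assms(1) True] DERIV_pos_inc_left[OF assms(1) True] by blast
  then show ?thesis using that[of "min d1 d2"] True assms(2) by auto
next
  case False
  then have l: "l < 0" using assms(3) by simp
  obtain d1 d2 where "d1 > 0" "d2 > 0" "\<And>h. 0 < h \<Longrightarrow> h < d1 \<Longrightarrow> g z > g (z + h)"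
      "\<And>h. 0 < h \<Longrightarrow> h < d2 \<Longrightarrow> g (z - h) > g z"
    using DERIV_neg_dec_right[OF assms(1) l] DERIV_neg_dec_left[OF assms(1) l] by blast
  then show ?thesis using that[of "min d1 d2"] l assms(2) by auto
qed

text \<open>The sign of \<open>g\<close> is constant between zeros and jumps by
  \<open>2 * sgn (g' t)\<close> at a simple zero, so the sum telescopes. The induction removes the
  leftmost zero.\<close>

lemma sum_sgn_simple_zeros:
  fixes g g' :: "real \<Rightarrow> real"
  assumes deriv: "\<And>t. (g has_real_derivative g' t) (at t)"
    and simple: "\<And>t. g t = 0 \<Longrightarrow> g' t \<noteq> 0"
    and "a \<le> b" "g a \<noteq> 0" "g b \<noteq> 0" "finite {t. a < t \<and> t < b \<and> g t = 0}"
  shows "2 * (\<Sum>t | a < t \<and> t < b \<and> g t = 0. sgn (g' t)) = sgn (g b) - sgn (g a)"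
  using assms(3-)
proof (induction "card {t. a < t \<and> t < b \<and> g t = 0}" arbitrary: a)
  case 0
  then have none: "{t. a < t \<and> t < b \<and> g t = 0} = {}" by simp
  have "g t \<noteq> 0" if "a \<le> t" "t \<le> b" for t
    using that none 0 by (cases "t = a"; cases "t = b") auto
  then have "sgn (g a) = sgn (g b)"
    by (intro sgn_eq_if_no_zero DERIV_isCont[OF deriv] 0(2))
  then show ?case unfolding none by simp
next
  case (Suc n)
  let ?Z = "\<lambda>a. {t. a < t \<and> t < b \<and> g t = 0}"
  define z where "z = Min (?Z a)"
  have ne: "?Z a \<noteq> {}" using Suc.hyps(2) by (metis card.empty nat.distinct(1))
  have z: "a < z" "z < b" "g z = 0" and zmin: "\<And>t. t \<in> ?Z a \<Longrightarrow> z \<le> t"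
    using Min_in[OF Suc.prems(4) ne] Min_le[OF Suc.prems(4)] by (auto simp: z_def)
  obtain d where d: "d > 0" "\<And>h. 0 < h \<Longrightarrow> h < d \<Longrightarrow> sgn (g (z + h)) = sgn (g' z) \<and> sgn (g (z - h)) = - sgn (g' z)"
    using sgn_near_simple_zero[OF deriv z(3) simple[OF z(3)]] by blast
  define h where "h = min d (min (b - z) (z - a)) / 2"
  have h: "0 < h" "h < d" "z + h < b" "a < z - h"
    using d(1) z unfolding h_def min_def by (auto simp: field_simps)
  \<comment> \<open>New left end: beyond \<open>z\<close> but before the next zero, so
    \<open>g c\<close> is nonzero as the induction hypothesis demands, and exactly \<open>z\<close>
    is lost from the zero set.\<close>
  define c where "c = z + h"
  have c: "z < c" "c < b" "sgn (g c) = sgn (g' z)" using h d(2)[OF h(1,2)] by (auto simp: c_def)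
  have gc: "g c \<noteq> 0" using c(3) simple[OF z(3)] by (auto simp: sgn_zero_iff)
  have "g t \<noteq> 0" if "a \<le> t" "t \<le> z - h" for t
    using zmin[of t] that h z Suc.prems(2) by (cases "t = a") auto
  then have sa: "sgn (g a) = - sgn (g' z)"
    using d(2)[OF h(1,2)] h deriv DERIV_isCont sgn_eq_if_no_zero[of a "z - h" g] by force
  have right: "g t \<noteq> 0" if "z < t" "t \<le> c" for t
    using d(2)[of "t - z"] that h simple[OF z(3)] by (auto simp: c_def sgn_zero_iff)
  have split: "?Z a = insert z (?Z c)"
  proof
    show "?Z a \<subseteq> insert z (?Z c)"
    proof
      fix t assume t: "t \<in> ?Z a"
      have "t = z \<or> z < t" using zmin[OF t] by linarith
      then show "t \<in> insert z (?Z c)" using t right[of t] by (cases "t \<le> c") auto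
    qed
    show "insert z (?Z c) \<subseteq> ?Z a" using z c by auto
  qed
  have fin: "finite (?Z c)" using Suc.prems(4) unfolding split by simp
  have "z \<notin> ?Z c" using c by simp
  then have "n = card (?Z c)" using Suc.hyps(2) fin unfolding split by simp
  from Suc.hyps(1)[OF this] have "2 * (\<Sum>t\<in>?Z c. sgn (g' t)) = sgn (g b) - sgn (g c)"
    using c gc Suc.prems fin by simp
  then show ?case unfolding split using \<open>z \<notin> ?Z c\<close> fin sa c(3) by (simp add: algebra_simps)
qed

context saddle_form
begin

text \<open>The zeros of \<open>f\<close> with \<open>f' > 0\<close> and those with \<open>f' < 0\<close> alternate on the circle, so \<open>F\<close> is
  radial at half of the \<open>2 k\<close> zeros.\<close>

lemma card_radial: "card {z. norm z = 1 \<and> z \<in> F z} = k"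
proof -
  \<comment> \<open>Starting the period at an angle that is not a zero puts all zeros in its
    interior; the values of \<open>f\<close> at the two ends agree, so the signs of
    \<open>f'\<close> at the zeros sum to 0.\<close>
  obtain a where a: "f a \<noteq> 0"
  proof (cases "f 0 = 0")
    case True
    then obtain d where "d > 0" "\<And>h. 0 < h \<Longrightarrow> h < d \<Longrightarrow> sgn (f (0 + h)) = sgn (f' 0) \<and> sgn (f (0 - h)) = - sgn (f' 0)"
      using sgn_near_simple_zero[OF f_derivative _ f_simple_zero] by blast
    then have "sgn (f (0 + d / 2)) = sgn (f' 0)" by simp
    then have "f (d / 2) \<noteq> 0" using f_simple_zero[OF True] by (metis add_0 sgn_zero_iff)
    then show ?thesis by (rule that)
  qed
  define Z where "Z = {t. a < t \<and> t < a + 2 * pi \<and> f t = 0}"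
  have fp: "f (t + 2 * pi) = f t" for t by (simp add: f_def unit_vector_periodic)
  have Z: "Z \<subseteq> {a..<a + 2 * pi}" by (auto simp: Z_def)
  have onto: "\<exists>t. a < t \<and> t < a + 2 * pi \<and> z = unit_vector t" if z: "norm z = 1" "P z = 0" for z
  proof -
    obtain t where t: "z = unit_vector t" using ex_unit_vector[OF z(1)] by blast
    define n where "n = - \<lfloor>(t - a) / (2 * pi)\<rfloor>"
    define s where "s = t + 2 * pi * of_int n"
    have s: "z = unit_vector s" unfolding s_def unit_vector_periodic_int by (rule t)
    have "of_int (- n) \<le> (t - a) / (2 * pi)" "(t - a) / (2 * pi) < of_int (- n) + 1"
      unfolding n_def by simp_all
    then have "a \<le> s" "s < a + 2 * pi" by (simp_all add: s_def field_simps)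
    moreover have "s \<noteq> a" using z(2) s a by (auto simp: f_def)
    ultimately show ?thesis using s by (intro exI[of _ s]) auto
  qed
  have img: "unit_vector ` Z = {z. norm z = 1 \<and> P z = 0}"
    using onto by (fastforce simp: Z_def f_def)
  have imgr: "unit_vector ` {t \<in> Z. f' t < 0} = {z. norm z = 1 \<and> z \<in> F z}"
  proof -
    have "z \<in> F z \<longleftrightarrow> P z = 0 \<and> T z < 0" if "norm z = 1" for z
      using that by (intro radial_iff) auto
    note r = this
    show ?thesis
    proof (intro set_eqI iffI)
      fix z assume "z \<in> unit_vector ` {t \<in> Z. f' t < 0}"
      then show "z \<in> {z. norm z = 1 \<and> z \<in> F z}" using r[of z] by (auto simp: Z_def f_def f'_def)
    next
      fix z assume "z \<in> {z. norm z = 1 \<and> z \<in> F z}"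
      then have z: "norm z = 1" "P z = 0" "T z < 0" using r[of z] by auto
      obtain t where "a < t" "t < a + 2 * pi" "z = unit_vector t" using onto[OF z(1,2)] by blast
      then show "z \<in> unit_vector ` {t \<in> Z. f' t < 0}" using z by (auto simp: Z_def f_def f'_def)
    qed
  qed
  have inj: "inj_on unit_vector Z" using inj_on_unit_vector Z inj_on_subset by blast
  have cZ: "card Z = 2 * k" using card_image[OF inj] card_zeros img by simp
  then have fin: "finite Z" using k_ge_2 by (metis card.infinite mult_is_0 not_numeral_le_zero zero_neq_numeral)
  have "2 * (\<Sum>t\<in>Z. sgn (f' t)) = sgn (f (a + 2 * pi)) - sgn (f a)"
    unfolding Z_def
    by (rule sum_sgn_simple_zeros[OF f_derivative f_simple_zero]) (use a fp fin in \<open>auto simp: Z_def\<close>)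
  then have "(\<Sum>t\<in>Z. sgn (f' t)) = 0" by (simp add: fp)
  moreover have split: "Z = {t \<in> Z. f' t < 0} \<union> {t \<in> Z. f' t > 0}"
    using f_simple_zero by (auto simp: Z_def) (metis linorder_neqE_linordered_idom)
  moreover have "(\<Sum>t\<in>{t \<in> Z. f' t < 0} \<union> {t \<in> Z. f' t > 0}. sgn (f' t))
      = (\<Sum>t\<in>{t \<in> Z. f' t < 0}. sgn (f' t)) + (\<Sum>t\<in>{t \<in> Z. f' t > 0}. sgn (f' t))"
    using fin by (intro sum.union_disjoint) auto
  ultimately have "real (card {t \<in> Z. f' t < 0}) = real (card {t \<in> Z. f' t > 0})" by simp
  moreover have "card Z = card {t \<in> Z. f' t < 0} + card {t \<in> Z. f' t > 0}"
    using fin by (subst split, intro card_Un_disjoint) auto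
  ultimately have "card {t \<in> Z. f' t < 0} = k" using cZ by simp
  moreover have "card (unit_vector ` {t \<in> Z. f' t < 0}) = card {t \<in> Z. f' t < 0}"
    using inj by (intro card_image) (auto intro: inj_on_subset)
  ultimately show ?thesis using imgr by simp
qed

lemma finite_radial: "finite {z. norm z = 1 \<and> z \<in> F z}"
  using card_radial k_ge_2 by (metis card.infinite not_numeral_le_zero)

lemma radial_periodic_int: "radial (t + 2 * pi * of_int n) \<longleftrightarrow> radial t"
  by (simp add: radial_def unit_vector_periodic_int)

text \<open>The radial angles form a closed periodic set, nonempty because \<open>k > 0\<close>; the
  nearest ones on either side of \<open>t\<close> are a supremum and an infimum.\<close>

lemma nonradial_between:
  assumes "\<not> radial t"
  obtains \<alpha> \<beta> where "\<alpha> < t" "t < \<beta>" "radial \<alpha>" "radial \<beta>" "\<And>s. \<alpha> < s \<Longrightarrow> s < \<beta> \<Longrightarrow> \<not> radial s"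
proof -
  have "{z. norm z = 1 \<and> z \<in> F z} \<noteq> {}"
    using card_radial k_ge_2 by (metis card.empty not_numeral_le_zero)
  then obtain r where r: "radial r" using ex_unit_vector by (metis (mono_tags, lifting) Collect_empty_eq radial_def)
  define n where "n = \<lfloor>(t - r) / (2 * pi)\<rfloor>"
  have "of_int n \<le> (t - r) / (2 * pi)" "(t - r) / (2 * pi) < of_int n + 1"
    unfolding n_def by simp_all
  then have lo: "r + 2 * pi * of_int n \<le> t" and hi: "t \<le> r + 2 * pi * of_int (n + 1)"
    by (simp_all add: field_simps)
  let ?L = "{..t} \<inter> {s. radial s}" and ?U = "{t..} \<inter> {s. radial s}"
  have L: "closed ?L" "bdd_above ?L" "?L \<noteq> {}"
    using closed_radial lo radial_periodic_int[of r n] r by (auto simp: bdd_above_def)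
  have U: "closed ?U" "bdd_below ?U" "?U \<noteq> {}"
    using closed_radial hi radial_periodic_int[of r "n + 1"] r by (auto simp: bdd_below_def simp del: of_int_add)
  have "Sup ?L \<in> ?L" "Inf ?U \<in> ?U"
    using closed_contains_Sup[OF L(3,2,1)] closed_contains_Inf[OF U(3,2,1)] .
  moreover have "s \<le> Sup ?L" if "radial s" "s \<le> t" for s using that L(2) by (intro cSup_upper) auto
  moreover have "Inf ?U \<le> s" if "radial s" "t \<le> s" for s using that U(2) by (intro cInf_lower) auto
  ultimately show ?thesis
    using that[of "Sup ?L" "Inf ?U"] assms by (smt (verit) IntD1 IntD2 atMost_iff atLeast_iff mem_Collect_eq)
qed

text \<open>The slope \<open>phi\<close> is unbounded towards the ends, so the antiderivative is
  taken on the open interval, from continuity there.\<close>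

lemma saddle_sector_exists:
  assumes "\<alpha> < \<beta>" "radial \<alpha>" "radial \<beta>" "\<And>s. \<alpha> < s \<Longrightarrow> s < \<beta> \<Longrightarrow> \<not> radial s"
  obtains \<Phi> where "saddle_sector k P Px Py A B C \<alpha> \<beta> \<Phi>"
proof -
  have "\<exists>\<Phi>. \<forall>x. ereal \<alpha> < ereal x \<longrightarrow> ereal x < ereal \<beta> \<longrightarrow> (\<Phi> has_vector_derivative phi x) (at x)"
    using assms isCont_phi by (intro einterval_antiderivative) auto
  then obtain \<Phi> where "\<And>x. \<alpha> < x \<Longrightarrow> x < \<beta> \<Longrightarrow> (\<Phi> has_real_derivative phi x) (at x)"
    by (auto simp: has_real_derivative_iff_has_vector_derivative)
  then show ?thesis using that[of \<Phi>] assms saddle_form_axioms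
    by (simp add: saddle_sector_def saddle_sector_axioms_def)
qed

subsection \<open>Classification of the asymptotic rays\<close>

text \<open>Closedness will show that no asymptotic ray passes through a nonradial point; the
  absence of radial points, that no curve meeting a radial ray reaches one.\<close>

lemma nonradial_line:
  assumes "p \<noteq> 0" "p \<notin> F p"
  obtains E where "p \<in> E" "asymptotic_line F E" "closed E" "\<And>q. q \<in> E \<Longrightarrow> q \<noteq> 0 \<and> q \<notin> F q"
proof -
  obtain t where p: "p = norm p *\<^sub>R unit_vector t" using polar_form[OF assms(1)] by blast
  have n: "norm p > 0" using assms(1) by simp
  then have "\<not> radial t" using assms(2) p radial_scaleR_iff by metis
  then obtain \<alpha> \<beta> where ab: "\<alpha> < t" "t < \<beta>" "radial \<alpha>" "radial \<beta>" "\<And>s. \<alpha> < s \<Longrightarrow> s < \<beta> \<Longrightarrow> \<not> radial s"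
    using nonradial_between by blast
  then obtain \<Phi> where "saddle_sector k P Px Py A B C \<alpha> \<beta> \<Phi>"
    using saddle_sector_exists[of \<alpha> \<beta>] by auto
  then interpret s: saddle_sector k P Px Py A B C \<alpha> \<beta> \<Phi> .
  define c where "c = ln (norm p) - \<Phi> t"
  show ?thesis
  proof (rule that[of "s.\<gamma> c ` {\<alpha><..<\<beta>}"])
    show "p \<in> s.\<gamma> c ` {\<alpha><..<\<beta>}"
      using s.through_point[OF n, of t] p ab by (auto simp: c_def)
    show "q \<noteq> 0 \<and> q \<notin> F q" if q: "q \<in> s.\<gamma> c ` {\<alpha><..<\<beta>}" for q
    proof -
      obtain x where x: "\<alpha> < x" "x < \<beta>" "q = s.\<gamma> c x" using q unfolding image_iff Bex_def by auto
      then show ?thesis using radial_scaleR_iff[of "exp (c + \<Phi> x)" x] ab(5)[of x] by (simp add: s.\<gamma>_def)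
    qed
  qed (fact s.asymptotic_line_\<gamma> s.closed_\<gamma>)+
qed

lemma integral_curve_ray:
  assumes "radial t"
  shows "integral_curve F {0<..} (\<lambda>r. r *\<^sub>R unit_vector t)"
  unfolding integral_curve_def
proof (intro conjI exI ballI)
  fix r :: real assume "r \<in> {0<..}"
  then have r: "r > 0" by simp
  show "((\<lambda>r. r *\<^sub>R unit_vector t) has_vector_derivative unit_vector t) (at r)"
    by (auto intro!: derivative_eq_intros)
  show "unit_vector t \<in> F (r *\<^sub>R unit_vector t)"
    using assms r by (simp add: F_homogeneous radial_def)
  show "r *\<^sub>R unit_vector t \<noteq> 0" using r by simp
qed (auto simp: is_interval_1 intro: exI[of _ 1])

text \<open>A curve meeting the ray visits radial points only, so its normalised position is a
  continuous map from an interval to the finite set of radial unit vectors, hence constant.\<close>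

lemma asymptotic_line_ray:
  assumes "radial t"
  shows "asymptotic_line F (ray 0 t)"
  unfolding asymptotic_line_def
proof (intro conjI allI impI)
  have "ray 0 t = (\<lambda>r. r *\<^sub>R unit_vector t) ` {0<..}" by (auto simp: ray_0_eq)
  then show "\<exists>I \<gamma>. integral_curve F I \<gamma> \<and> \<gamma> ` I = ray 0 t"
    using integral_curve_ray[OF assms] by metis
  fix J \<delta> assume \<delta>: "integral_curve F J \<delta> \<and> \<delta> ` J \<inter> ray 0 t \<noteq> {}"
  then obtain t0 where t0: "t0 \<in> J" "\<delta> t0 \<in> ray 0 t" by blast
  then have r0: "\<delta> t0 \<in> F (\<delta> t0)" using radial_scaleR_iff assms by (auto simp: ray_0_eq)
  have nz: "\<delta> s \<noteq> 0" if "s \<in> J" for s using \<delta> that by (auto simp: integral_curve_def)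
  text \<open>A curve through a nonradial point stays on a curve without radial points.\<close>
  have rad: "\<delta> s \<in> F (\<delta> s)" if s: "s \<in> J" for s
  proof (rule ccontr)
    assume "\<delta> s \<notin> F (\<delta> s)"
    then obtain E where E: "\<delta> s \<in> E" "asymptotic_line F E" "\<And>q. q \<in> E \<Longrightarrow> q \<noteq> 0 \<and> q \<notin> F q"
      using nonradial_line nz[OF s] by metis
    then have "\<delta> ` J \<subseteq> E" using \<delta> s unfolding asymptotic_line_def by blast
    then show False using E(3) t0(1) r0 by blast
  qed
  let ?d = "\<lambda>s. \<delta> s /\<^sub>R norm (\<delta> s)"
  have "connected J" using \<delta> by (simp add: integral_curve_def is_interval_connected_1)
  moreover have "continuous_on J \<delta>"
    using \<delta> has_vector_derivative_continuous unfolding integral_curve_def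
    by (intro continuous_at_imp_continuous_on) blast
  then have "continuous_on J ?d" using nz by (intro continuous_intros) auto
  moreover have "?d ` J \<subseteq> {z. norm z = 1 \<and> z \<in> F z}"
  proof (rule image_subsetI)
    fix s assume "s \<in> J"
    then have "\<delta> s \<in> F (\<delta> s)" "norm (\<delta> s) > 0" using nz rad by auto
    then show "?d s \<in> {z. norm z = 1 \<and> z \<in> F z}" by (simp add: F_homogeneous F_scaleR)
  qed
  then have "finite (?d ` J)" using finite_radial finite_subset by blast
  ultimately obtain e where "?d ` J = {e}"
    using connected_finite_iff_sing[of "?d ` J"] connected_continuous_image[of J ?d] t0(1) by blast
  then have "?d s = ?d t0" if "s \<in> J" for s using that t0(1) by (metis image_eqI singletonD)
  then have "?d s = unit_vector t" if "s \<in> J" for s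
    using t0 that unfolding mem_ray_0_iff by metis
  then show "\<delta> ` J \<subseteq> ray 0 t" using nz by (auto simp: mem_ray_0_iff)
qed

lemma not_closed_ray: "\<not> closed (ray p t)"
proof
  assume "closed (ray p t)"
  moreover have "p + inverse (real (Suc n)) *\<^sub>R unit_vector t \<in> ray p t" for n
  proof -
    have "inverse (real (Suc n)) > 0" by (intro positive_imp_inverse_positive) simp
    then show ?thesis unfolding ray_def by blast
  qed
  moreover have "(\<lambda>n. p + inverse (real (Suc n)) *\<^sub>R unit_vector t) \<longlonglongrightarrow> p + 0 *\<^sub>R unit_vector t"
    by (intro tendsto_intros LIMSEQ_inverse_real_of_nat)
  ultimately have "p + 0 *\<^sub>R unit_vector t \<in> ray p t" by (rule closed_sequentially)
  then show False by (auto simp: ray_def)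
qed

lemma asymptotic_line_eq:
  assumes "asymptotic_line H D" "asymptotic_line H E" "D \<inter> E \<noteq> {}"
  shows "D = E"
proof -
  have sub: "X \<subseteq> Y" if XY: "asymptotic_line H X" "asymptotic_line H Y" "X \<inter> Y \<noteq> {}" for X Y
  proof -
    obtain I \<gamma> where "integral_curve H I \<gamma>" "\<gamma> ` I = X" using XY(1) unfolding asymptotic_line_def by auto
    then show ?thesis using XY(2,3) unfolding asymptotic_line_def by auto
  qed
  show ?thesis using sub[of D E] sub[of E D] assms by (simp add: Int_commute subset_antisym)
qed

lemma asymptotic_line_nonzero:
  assumes "asymptotic_line H D" "q \<in> D"
  shows "q \<noteq> 0"
proof -
  obtain I \<gamma> where "integral_curve H I \<gamma>" "\<gamma> ` I = D" using assms(1) unfolding asymptotic_line_def by auto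
  then show ?thesis using assms(2) unfolding integral_curve_def by auto
qed

text \<open>A nonradial point lies on a closed asymptotic line, which would coincide with the ray;
  but a ray omits its endpoint and is not closed. So the point tested is radial, and the ray shares
  it with an asymptotic ray from the origin.\<close>

lemma asymptotic_ray_through_origin:
  assumes "asymptotic_line F (ray p t)"
  obtains s where "radial s" "ray p t = ray 0 s"
proof -
  have q: "p + 1 *\<^sub>R unit_vector t \<in> ray p t" unfolding ray_def using zero_less_one by blast
  define q where "q = p + 1 *\<^sub>R unit_vector t"
  have "q \<noteq> 0" using asymptotic_line_nonzero assms q unfolding q_def by blast
  then obtain s where s: "q = norm q *\<^sub>R unit_vector s" using polar_form by blast
  have "q \<in> F q"
  proof (rule ccontr)
    assume "q \<notin> F q"
    then obtain E where "q \<in> E" "asymptotic_line F E" "closed E" using nonradial_line \<open>q \<noteq> 0\<close> by metis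
    then have "ray p t = E" using asymptotic_line_eq assms q unfolding q_def by blast
    then show False using \<open>closed E\<close> not_closed_ray by blast
  qed
  then have "radial s" using s \<open>q \<noteq> 0\<close> radial_scaleR_iff by (metis zero_less_norm_iff)
  moreover have "q \<in> ray 0 s" using s \<open>q \<noteq> 0\<close> unfolding ray_0_eq by (metis (mono_tags, lifting) mem_Collect_eq zero_less_norm_iff)
  ultimately show ?thesis
    using that asymptotic_line_eq[OF assms asymptotic_line_ray] q unfolding q_def by blast
qed

lemma ray_0_eq_iff: "ray 0 s = ray 0 t \<longleftrightarrow> unit_vector s = unit_vector t"
proof
  assume "ray 0 s = ray 0 t"
  moreover have "unit_vector s \<in> ray 0 s" by (simp add: mem_ray_0_iff)
  ultimately show "unit_vector s = unit_vector t" by (simp add: mem_ray_0_iff)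
qed (simp add: ray_0_eq)

lemma asymptotic_line_ray_iff: "asymptotic_line F (ray 0 t) \<longleftrightarrow> radial t"
proof
  assume "asymptotic_line F (ray 0 t)"
  then obtain s where "radial s" "ray 0 t = ray 0 s" by (rule asymptotic_ray_through_origin)
  then show "radial t" by (simp add: ray_0_eq_iff radial_def)
qed (rule asymptotic_line_ray)

lemma asymptotic_rays_eq: "asymptotic_rays F = ray 0 ` {t. radial t}"
proof (intro set_eqI iffI)
  fix R assume "R \<in> asymptotic_rays F"
  then obtain p t where "R = ray p t" "asymptotic_line F (ray p t)" unfolding asymptotic_rays_def by blast
  then show "R \<in> ray 0 ` {t. radial t}" using asymptotic_ray_through_origin by (metis imageI mem_Collect_eq)
next
  fix R assume "R \<in> ray 0 ` {t. radial t}"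
  then show "R \<in> asymptotic_rays F" unfolding asymptotic_rays_def using asymptotic_line_ray by blast
qed

lemma card_asymptotic_rays: "card (asymptotic_rays F) = k"
proof -
  \<comment> \<open>Rays are counted by unit vectors, since angles name each ray infinitely
    often.\<close>
  have "bij_betw (\<lambda>z. {r *\<^sub>R z | r. r > 0}) {z. norm z = 1 \<and> z \<in> F z} (asymptotic_rays F)"
  proof (rule bij_betw_imageI)
    show "inj_on (\<lambda>z. {r *\<^sub>R z | r. r > 0}) {z. norm z = 1 \<and> z \<in> F z}"
    proof (rule inj_onI)
      fix x y :: "real \<times> real"
      assume "x \<in> {z. norm z = 1 \<and> z \<in> F z}" "y \<in> {z. norm z = 1 \<and> z \<in> F z}"
        and eq: "{r *\<^sub>R x | r. r > 0} = {r *\<^sub>R y | r. r > 0}"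
      then obtain s t where "x = unit_vector s" "y = unit_vector t" using ex_unit_vector by (metis (mono_tags, lifting) mem_Collect_eq)
      then show "x = y" using eq ray_0_eq_iff by (simp add: ray_0_eq)
    qed
    have "z \<in> unit_vector ` {t. radial t}" if z: "norm z = 1" "z \<in> F z" for z
    proof -
      obtain t where "z = unit_vector t" using ex_unit_vector[OF z(1)] by blast
      then show ?thesis using z(2) by (auto simp: radial_def)
    qed
    then have "{z. norm z = 1 \<and> z \<in> F z} = unit_vector ` {t. radial t}"
      by (auto simp: radial_def)
    then show "(\<lambda>z. {r *\<^sub>R z | r. r > 0}) ` {z. norm z = 1 \<and> z \<in> F z} = asymptotic_rays F"
      unfolding asymptotic_rays_eq by (simp add: image_image ray_0_eq)
  qed
  from bij_betw_same_card[OF this] show ?thesis using card_radial by argo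
qed

lemma hyperbolic_sector_F:
  assumes "adjacent_asymptotic_rays F \<alpha> \<beta>"
  shows "hyperbolic_sector F \<alpha> \<beta>"
proof -
  have ab: "\<alpha> < \<beta>" "radial \<alpha>" "radial \<beta>" "\<And>s. \<alpha> < s \<Longrightarrow> s < \<beta> \<Longrightarrow> \<not> radial s"
    using assms unfolding adjacent_asymptotic_rays_def asymptotic_line_ray_iff by auto
  then obtain \<Phi> where "saddle_sector k P Px Py A B C \<alpha> \<beta> \<Phi>" by (rule saddle_sector_exists)
  then interpret s: saddle_sector k P Px Py A B C \<alpha> \<beta> \<Phi> .
  have "\<exists>a b \<gamma>. traverses_sector F \<alpha> \<beta> a b \<gamma> \<and> q \<in> \<gamma> ` {a<..<b}" if "q \<in> sector \<alpha> \<beta>" for q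
  proof -
    from that obtain r t where "q = r *\<^sub>R unit_vector t" "r > 0" "\<alpha> < t" "t < \<beta>"
      unfolding sector_def by blast
    then have "q \<in> s.\<gamma> (ln r - \<Phi> t) ` {\<alpha><..<\<beta>}" using s.through_point[of r t] by auto
    then show ?thesis using s.traverses_sector_\<gamma> by blast
  qed
  then show ?thesis
    unfolding hyperbolic_sector_def
    using asymptotic_line_ray ab(2,3) s.passage_near_origin by blast
qed

subsection \<open>Singular points\<close>

lemma singular_point_F_imp_origin:
  assumes "singular_point F p"
  shows "p = 0"
proof (rule ccontr)
  assume "p \<noteq> 0"
  then have "line_field_on (ball p (norm p)) F" by (intro line_field_on_F) simp
  then show False using assms \<open>p \<noteq> 0\<close> unfolding singular_point_def by (metis zero_less_norm_iff)
qed

lemma not_singular_point_F_degree_2: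
  assumes "k = 2"
  shows "\<not> singular_point F 0"
proof -
  \<comment> \<open>Homogeneity of degree 0 at the factor \<open>r = 0\<close>, where
    \<open>0 ^ 0 = 1\<close>: the Hessian takes its value at the origin everywhere.\<close>
  have const: "A p = A 0" "B p = B 0" "C p = C 0" for p
    using A_homogeneous[of 0 p] B_homogeneous[of 0 p] C_homogeneous[of 0 p] assms by simp_all
  have "(B 0)\<^sup>2 - A 0 * C 0 > 0"
    using discriminant_pos[of "(1, 0)"] const by (metis prod.inject zero_neq_one zero_prod_def)
  then have "(B p)\<^sup>2 - A p * C p > 0" for p using const by metis
  then have "line_field_on (ball 0 1) F"
    unfolding F_def by (intro line_field_on_null_line cont_A cont_B cont_C)
  then show ?thesis unfolding singular_point_def by (metis zero_less_one)
qed

text \<open>A continuous extension of a field that is constant along rays would be constant, hence radial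
  in two directions only.\<close>

lemma singular_point_F_origin:
  assumes "k \<ge> 3"
  shows "singular_point F 0"
  unfolding singular_point_def
proof
  assume "\<exists>\<epsilon>>0. \<exists>G. line_field_on (ball 0 \<epsilon>) G \<and> (\<forall>q\<in>ball 0 \<epsilon> - {0}. G q = F q)"
  then obtain \<epsilon> G where \<epsilon>: "\<epsilon> > 0" "line_field_on (ball 0 \<epsilon>) G" and G: "\<And>q. q \<in> ball 0 \<epsilon> - {0} \<Longrightarrow> G q = F q"
    by blast
  obtain U v where U: "open U" "0 \<in> U" "continuous_on (U \<inter> ball 0 \<epsilon>) v"
      "\<And>q. q \<in> U \<inter> ball 0 \<epsilon> \<Longrightarrow> v q \<noteq> 0 \<and> G q = span {v q}"
    using \<epsilon> unfolding line_field_on_def by (metis centre_in_ball)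
  define e where "e = v 0"
  have "e \<noteq> 0" using U(2,4) \<epsilon>(1) by (simp add: e_def)
  have "e \<in> F z" if z: "norm z = 1" for z
  proof -
    have "isCont v 0"
      using U(1,2,3) \<epsilon>(1) by (simp add: continuous_on_eq_continuous_at open_Int)
    moreover have lim: "((\<lambda>r. r *\<^sub>R z) \<longlongrightarrow> 0 *\<^sub>R z) (at_right 0)"
      by (intro tendsto_intros)
    ultimately have v: "((\<lambda>r. v (r *\<^sub>R z)) \<longlongrightarrow> e) (at_right 0)"
      unfolding e_def using isCont_tendsto_compose by fastforce
    have "eventually (\<lambda>r. r *\<^sub>R z \<in> U \<inter> ball 0 \<epsilon>) (at_right 0)"
      using lim U(1,2) \<epsilon>(1) by (intro topological_tendstoD) auto
    moreover have "eventually (\<lambda>r::real. 0 < r) (at_right 0)" by (simp add: eventually_at_right_less)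
    ultimately have "eventually (\<lambda>r. v (r *\<^sub>R z) \<in> F z) (at_right 0)"
    proof eventually_elim
      case (elim r)
      then have "v (r *\<^sub>R z) \<in> G (r *\<^sub>R z)" using U(4)[of "r *\<^sub>R z"] span_base by blast
      then show ?case using elim G[of "r *\<^sub>R z"] z F_homogeneous[of r z] by fastforce
    qed
    moreover have "closed (F z)" using subspace_F closed_subspace by blast
    ultimately show ?thesis using v by (intro Lim_in_closed_set[of "F z" _ "at_right 0"]) auto
  qed
  note eF = this
  have "{z. norm z = 1 \<and> z \<in> F z} \<subseteq> {e /\<^sub>R norm e, - (e /\<^sub>R norm e)}"
  proof
    fix z assume "z \<in> {z. norm z = 1 \<and> z \<in> F z}"
    then have z: "norm z = 1" "z \<in> F z" by auto
    have "z \<noteq> 0" using z(1) by auto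
    then have "wedge z e = 0" using z(2) eF[OF z(1)] by (rule F_wedge)
    then obtain c where c: "z = c *\<^sub>R e" using wedge_eq_0_imp_scaleR \<open>e \<noteq> 0\<close> by blast
    then have "\<bar>c\<bar> = inverse (norm e)" using z(1) \<open>e \<noteq> 0\<close> by (simp add: field_simps)
    then have "c = inverse (norm e) \<or> c = - inverse (norm e)" by linarith
    then show "z \<in> {e /\<^sub>R norm e, - (e /\<^sub>R norm e)}" using c by auto
  qed
  then have "card {z. norm z = 1 \<and> z \<in> F z} \<le> card {e /\<^sub>R norm e, - (e /\<^sub>R norm e)}" by (intro card_mono) auto
  also have "\<dots> \<le> 2" by (simp add: card_insert_if)
  finally show False using card_radial assms by simp
qed

lemma singular_points_F: "{p. singular_point F p} = (if k = 2 then {} else {0})"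
proof (cases "k = 2")
  case True
  have "\<not> singular_point F p" for p
    using singular_point_F_imp_origin[of p] not_singular_point_F_degree_2[OF True] by auto
  then show ?thesis using True by simp
next
  case False
  then have "k \<ge> 3" using k_ge_2 by simp
  then show ?thesis using False singular_point_F_imp_origin singular_point_F_origin by auto
qed

text \<open>For the uniqueness of the two fields: the residual of the eigenvector equations on a
  local spanning vector of \<open>H\<close> is continuous, so not lying in \<open>F\<close> is an
  open condition.\<close>

lemma open_not_subset_F:
  assumes "line_field_on (- {0}) H"
  shows "open {p. p \<noteq> 0 \<and> \<not> H p \<subseteq> F p}"
proof (rule Topological_Spaces.openI)
  fix p assume "p \<in> {p. p \<noteq> 0 \<and> \<not> H p \<subseteq> F p}"
  then have p: "p \<noteq> 0" "\<not> H p \<subseteq> F p" by auto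
  obtain U v where U: "open U" "p \<in> U" "continuous_on (U \<inter> - {0}) v"
      and v: "\<And>q. q \<in> U \<inter> - {0} \<Longrightarrow> H q = span {v q}"
    using assms p(1) unfolding line_field_on_def by (metis ComplI singletonD)
  define r where "r q = (A q * fst (v q) + B q * snd (v q) - S q * snd (v q),
      B q * fst (v q) + C q * snd (v q) + S q * fst (v q))" for q
  have "continuous_on (U \<inter> - {0}) r"
    unfolding r_def
    by (intro continuous_intros U(3) continuous_on_subset[OF cont_A] continuous_on_subset[OF cont_B]
        continuous_on_subset[OF cont_C]) auto
  then have "open ((U \<inter> - {0}) \<inter> r -` (- {0}))"
    using U(1) by (intro continuous_open_preimage) auto
  moreover have r: "r q = 0 \<longleftrightarrow> H q \<subseteq> F q" if "q \<in> U \<inter> - {0}" for q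
  proof -
    have "r q = 0 \<longleftrightarrow> v q \<in> F q" by (auto simp: r_def mem_F_iff zero_prod_def)
    also have "\<dots> \<longleftrightarrow> H q \<subseteq> F q"
      unfolding v[OF that] using span_minimal[OF _ subspace_F] span_superset by blast
    finally show ?thesis .
  qed
  then have "p \<in> (U \<inter> - {0}) \<inter> r -` (- {0})" using p U(2) by auto
  moreover have "(U \<inter> - {0}) \<inter> r -` (- {0}) \<subseteq> {p. p \<noteq> 0 \<and> \<not> H p \<subseteq> F p}"
  proof
    fix q assume "q \<in> (U \<inter> - {0}) \<inter> r -` (- {0})"
    then show "q \<in> {p. p \<noteq> 0 \<and> \<not> H p \<subseteq> F p}" using r[of q] by simp
  qed
  ultimately show "\<exists>T. open T \<and> p \<in> T \<and> T \<subseteq> {p. p \<noteq> 0 \<and> \<not> H p \<subseteq> F p}" by blast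
qed

end

subsection \<open>Products of linear forms\<close>

lemma partials_of_has_derivative:
  assumes "(g has_derivative D) (at p)"
  shows "partial_x g p = D (1, 0)" "partial_y g p = D (0, 1)"
proof -
  obtain x y where p: "p = (x, y)" by force
  interpret D: bounded_linear D using assms by (rule has_derivative_bounded_linear)
  have "((\<lambda>t. (t, y)) has_derivative (\<lambda>h. (h, 0))) (at x)" "((\<lambda>t. (x, t)) has_derivative (\<lambda>h. (0, h))) (at y)"
    by (auto intro!: derivative_eq_intros)
  then have "((\<lambda>t. g (t, y)) has_derivative (\<lambda>h. D (h, 0))) (at x)"
    "((\<lambda>t. g (x, t)) has_derivative (\<lambda>h. D (0, h))) (at y)"
    using has_derivative_compose assms unfolding p by blast+
  note sections = this
  have D1: "D (h, 0) = D (1, 0) * h" and D2: "D (0, h) = D (0, 1) * h" for h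
    using D.scaleR[of h "(1, 0)"] D.scaleR[of h "(0, 1)"] by (simp_all add: mult.commute)
  have "((\<lambda>t. g (t, y)) has_real_derivative D (1, 0)) (at x)"
    "((\<lambda>t. g (x, t)) has_real_derivative D (0, 1)) (at y)"
    unfolding has_field_derivative_def
    using has_derivative_eq_rhs[OF sections(1) ext[OF D1]] has_derivative_eq_rhs[OF sections(2) ext[OF D2]] .
  then show "partial_x g p = D (1, 0)" "partial_y g p = D (0, 1)"
    by (simp_all add: partial_x_def partial_y_def p DERIV_imp_deriv)
qed

locale linear_forms =
  fixes k :: nat and a b :: "nat \<Rightarrow> real"
  assumes k2: "2 \<le> k"
    and nonproportional: "\<And>i j. i \<in> {1..k} \<Longrightarrow> j \<in> {1..k} \<Longrightarrow> i \<noteq> j \<Longrightarrow>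
           \<not> (\<exists>c. a i = c * a j \<and> b i = c * b j)"
begin

definition l :: "nat \<Rightarrow> real \<times> real \<Rightarrow> real" where "l i p = a i * fst p + b i * snd p"

text \<open>Products over arbitrary index sets, because each differentiation deletes a
  factor.\<close>

definition Q :: "nat set \<Rightarrow> real \<times> real \<Rightarrow> real" where "Q I p = (\<Prod>i\<in>I. l i p)"

abbreviation I :: "nat set" where "I \<equiv> {1..k}"

text \<open>Derivative of the product when factor \<open>i\<close> has derivative
  \<open>c i\<close>: \<open>a\<close> and \<open>b\<close> give the partial derivatives,
  \<open>\<lambda>i. l i v\<close> the derivative along \<open>v\<close>. A direction thus becomes a
  linear parameter of \<open>D1\<close> and \<open>D2\<close>, which covers Euler's relations and
  the Hessian on any vector.\<close>

definition D1 :: "(nat \<Rightarrow> real) \<Rightarrow> real \<times> real \<Rightarrow> real" where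
  "D1 c p = (\<Sum>i\<in>I. c i * Q (I - {i}) p)"

definition D2 :: "(nat \<Rightarrow> real) \<Rightarrow> (nat \<Rightarrow> real) \<Rightarrow> real \<times> real \<Rightarrow> real" where
  "D2 c d p = (\<Sum>i\<in>I. c i * (\<Sum>j\<in>I - {i}. d j * Q (I - {i} - {j}) p))"

lemma Q_derivative: "(Q J has_derivative (\<lambda>h. \<Sum>i\<in>J. l i h * Q (J - {i}) p)) (at p)"
  unfolding Q_def[abs_def] l_def[abs_def]
  by (rule has_derivative_prod) (auto intro!: derivative_eq_intros)

lemma D1_derivative:
  "(D1 c has_derivative (\<lambda>h. \<Sum>i\<in>I. c i * (\<Sum>j\<in>I - {i}. l j h * Q (I - {i} - {j}) p))) (at p)"
  unfolding D1_def[abs_def] by (intro has_derivative_sum has_derivative_mult_right Q_derivative)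

lemma partials:
  "partial_x (Q I) = D1 a" "partial_y (Q I) = D1 b"
  "partial_x (D1 c) = D2 c a" "partial_y (D1 c) = D2 c b"
  using partials_of_has_derivative[OF Q_derivative] partials_of_has_derivative[OF D1_derivative]
  by (auto simp: D1_def D2_def l_def)

lemma second_fundamental_form_Q:
  "second_fundamental_form (Q I) p v =
     D2 a a p * (fst v)\<^sup>2 + 2 * D2 a b p * fst v * snd v + D2 b b p * (snd v)\<^sup>2"
  unfolding second_fundamental_form_def partials by (simp add: case_prod_beta)

lemma Q_remove: "i \<in> J \<Longrightarrow> finite J \<Longrightarrow> l i p * Q (J - {i}) p = Q J p"
  by (simp add: Q_def prod.remove)

lemma euler_Q: "finite J \<Longrightarrow> (\<Sum>i\<in>J. l i p * Q (J - {i}) p) = real (card J) * Q J p"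
  by (simp add: Q_remove)

lemma Q_scaleR: "Q J (r *\<^sub>R p) = r ^ card J * Q J p"
proof -
  have "l i (r *\<^sub>R p) = r * l i p" for i by (simp add: l_def algebra_simps)
  then show ?thesis by (simp add: Q_def prod.distrib)
qed

lemma D1_combine: "u * D1 c p + v * D1 d p = D1 (\<lambda>i. c i * u + d i * v) p"
  unfolding D1_def sum_distrib_left by (simp add: algebra_simps sum.distrib)

lemma D2_combine: "u * D2 c d p + v * D2 c e p = D2 c (\<lambda>i. d i * u + e i * v) p"
  unfolding D2_def sum_distrib_left by (simp add: algebra_simps sum.distrib)

lemma D2_commute: "D2 c d p = D2 d c p"
proof -
  have r: "I - {i} = {j \<in> I. j \<noteq> i}" for i by auto
  have "D2 c d p = (\<Sum>i\<in>I. \<Sum>j\<in>{j \<in> I. j \<noteq> i}. c i * d j * Q (I - {i, j}) p)"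
    unfolding D2_def sum_distrib_left
    by (intro sum.cong) (auto simp: algebra_simps Diff_insert2[symmetric] insert_commute)
  also have "\<dots> = (\<Sum>j\<in>I. \<Sum>i\<in>{i \<in> I. j \<noteq> i}. c i * d j * Q (I - {i, j}) p)"
    by (rule sum.swap_restrict) auto
  also have "\<dots> = D2 d c p"
    unfolding D2_def sum_distrib_left
    by (intro sum.cong) (auto simp: algebra_simps Diff_insert2[symmetric] insert_commute)
  finally show ?thesis .
qed

lemma euler_D1: "fst p * D1 a p + snd p * D1 b p = real k * Q I p"
  using euler_Q[of I p] unfolding D1_combine by (simp add: D1_def l_def)

lemma euler_D2: "fst p * D2 c a p + snd p * D2 c b p = (real k - 1) * D1 c p"
proof -
  have "(\<Sum>j\<in>I - {i}. l j p * Q (I - {i} - {j}) p) = (real k - 1) * Q (I - {i}) p" if "i \<in> I" for i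
    using euler_Q[of "I - {i}" p] that k2 by (simp add: of_nat_diff)
  then have "D2 c (\<lambda>i. l i p) p = (\<Sum>i\<in>I. c i * ((real k - 1) * Q (I - {i}) p))"
    unfolding D2_def by (intro sum.cong) auto
  then show ?thesis unfolding D2_combine
    by (simp add: D1_def l_def sum_distrib_left algebra_simps)
qed

lemma D2_scaleR: "D2 c d (r *\<^sub>R p) = r ^ (k - 2) * D2 c d p"
proof -
  have "card (I - {i} - {j}) = k - 2" if "i \<in> I" "j \<in> I - {i}" for i j
    using that by (simp add: card_Diff_singleton)
  then show ?thesis
    unfolding D2_def sum_distrib_left by (intro sum.cong) (auto simp: Q_scaleR)
qed

lemma continuous_on_D2: "continuous_on UNIV (D2 c d)"
  unfolding D2_def[abs_def] Q_def l_def by (intro continuous_intros)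

lemma coefficients_nonzero:
  assumes "i \<in> I"
  shows "(a i, b i) \<noteq> 0"
proof -
  obtain j where "j \<in> I" "j \<noteq> i"
    using k2 assms by (metis One_nat_def Suc_1 atLeastAtMost_iff le_refl le_trans nat.inject n_not_Suc_n one_le_numeral)
  then show ?thesis using nonproportional[OF assms, of j] by (auto simp: zero_prod_def intro: exI[of _ 0])
qed

lemma common_zero:
  assumes "i \<in> I" "j \<in> I" "l i p = 0" "l j p = 0" "p \<noteq> 0"
  shows "i = j"
proof (rule ccontr)
  assume "i \<noteq> j"
  have "fst p * wedge (a i, b i) (a j, b j) = 0" "snd p * wedge (a i, b i) (a j, b j) = 0"
    using assms(3,4) unfolding l_def wedge_def fst_conv snd_conv by algebra+
  then have "wedge (a i, b i) (a j, b j) = 0" using assms(5) by (auto simp: prod_eq_iff)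
  then obtain c where "(a i, b i) = c *\<^sub>R (a j, b j)"
    using wedge_eq_0_imp_scaleR coefficients_nonzero[OF assms(2)] by blast
  then show False using nonproportional[OF assms(1,2) \<open>i \<noteq> j\<close>] by auto
qed

lemma discriminant_pos:
  assumes "p \<noteq> 0"
  shows "(D2 a b p)\<^sup>2 - D2 a a p * D2 b b p > 0"
proof -
  define A B C where "A = D2 a a p" and "B = D2 a b p" and "C = D2 b b p"
  define x y where "x = fst p" and "y = snd p"
  define g h where "g = D1 a p" and "h = D1 b p"
  define m where "m = real k - 1"
  have m: "m > 0" using k2 by (simp add: m_def)
  have e: "x * A + y * B = m * g" "x * B + y * C = m * h" "x * g + y * h = real k * Q I p"
    using euler_D2[of p a] euler_D2[of p b] euler_D1[of p] D2_commute[of a b p]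
    by (simp_all add: A_def B_def C_def x_def y_def g_def h_def m_def)
  have grad: "g * u + h * v = (\<Sum>i\<in>I. l i (u, v) * Q (I - {i}) p)" for u v
    using D1_combine[of u a p v b] by (simp add: g_def h_def D1_def l_def mult.commute)
  show ?thesis
  proof (cases "Q I p = 0")
    case True
    then obtain i where i: "i \<in> I" "l i p = 0" by (auto simp: Q_def)
    have "Q (I - {j}) p = 0" if "j \<in> I" "j \<noteq> i" for j
      using i that by (auto simp: Q_def)
    then have "(\<Sum>j\<in>I - {i}. l j (- y, x) * Q (I - {j}) p) = 0" by (intro sum.neutral) auto
    then have T: "h * x - g * y = l i (- y, x) * Q (I - {i}) p"
      using grad[of "- y" x] sum.remove[of I i "\<lambda>j. l j (- y, x) * Q (I - {j}) p"] i(1) by (simp add: mult.commute)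
    have "l i (- y, x) \<noteq> 0"
    proof
      assume "l i (- y, x) = 0"
      then have "(x\<^sup>2 + y\<^sup>2) * a i = 0" "(x\<^sup>2 + y\<^sup>2) * b i = 0"
        using i(2) unfolding l_def x_def y_def fst_conv snd_conv by algebra+
      moreover have "x\<^sup>2 + y\<^sup>2 \<noteq> 0" using assms by (simp add: x_def y_def prod_eq_iff sum_power2_eq_zero_iff)
      ultimately show False using coefficients_nonzero[OF i(1)] by (metis mult_eq_0_iff zero_prod_def)
    qed
    moreover have "Q (I - {i}) p \<noteq> 0"
      using common_zero[OF i(1) _ i(2) _ assms] by (auto simp: Q_def)
    ultimately have "(m * (h * x - g * y))\<^sup>2 > 0" unfolding T using m by simp
    \<comment> \<open>In the frame \<open>p\<close>, \<open>rot p\<close> the Hessian has a zero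
      diagonal entry by Euler's relation and the off-diagonal entry
      \<open>m * (h * x - g * y)\<close>; the factor \<open>(x\<^sup>2 + y\<^sup>2)\<^sup>2\<close>
      is the squared determinant of the frame.\<close>
    moreover have "(B\<^sup>2 - A * C) * (x\<^sup>2 + y\<^sup>2)\<^sup>2 = (m * (h * x - g * y))\<^sup>2"
      using e True by algebra
    ultimately have "(B\<^sup>2 - A * C) * (x\<^sup>2 + y\<^sup>2)\<^sup>2 > 0" by simp
    then have "B\<^sup>2 - A * C > 0" by (metis zero_le_power2 mult_pos_pos zero_less_mult_pos2 less_eq_real_def mult_zero_right less_irrefl)
    then show ?thesis by (simp add: A_def B_def C_def)
  next
    case False
    have lnz: "l i p \<noteq> 0" if "i \<in> I" for i using False that by (auto simp: Q_def)
    \<comment> \<open>Logarithmic derivative of factor \<open>i\<close> along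
      \<open>(- h, g)\<close>, the tangent of the level curve through \<open>p\<close>; their sum is
      the logarithmic derivative of the product, hence 0.\<close>
    define c where "c i = l i (- h, g) / l i p" for i
    have lc: "l i (- h, g) = c i * l i p" if "i \<in> I" for i using lnz[OF that] by (simp add: c_def)
    have "(\<Sum>i\<in>I. l i (- h, g) * Q (I - {i}) p) = (\<Sum>i\<in>I. c i * Q I p)"
      by (intro sum.cong refl) (simp add: lc Q_remove[symmetric])
    then have c0: "(\<Sum>i\<in>I. c i) = 0"
      using grad[of "- h" g] False by (simp add: mult.commute flip: sum_distrib_right)
    define q where "q = A * h\<^sup>2 - 2 * B * h * g + C * g\<^sup>2"
    \<comment> \<open>Differentiating the product without factor \<open>i\<close>: the remaining
      \<open>c j\<close> sum to \<open>- c i\<close>, which turns the Hessian into minus a sum of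
      squares times the product.\<close>
    have inner: "(\<Sum>j\<in>I - {i}. l j (- h, g) * Q (I - {i} - {j}) p) = - c i * Q (I - {i}) p" if i: "i \<in> I" for i
    proof -
      have "(\<Sum>j\<in>I - {i}. l j (- h, g) * Q (I - {i} - {j}) p) = (\<Sum>j\<in>I - {i}. c j * Q (I - {i}) p)"
      proof (intro sum.cong refl)
        fix j assume j: "j \<in> I - {i}"
        then show "l j (- h, g) * Q (I - {i} - {j}) p = c j * Q (I - {i}) p"
          using Q_remove[of j "I - {i}" p] by (simp add: lc)
      qed
      also have "\<dots> = (\<Sum>j\<in>I - {i}. c j) * Q (I - {i}) p" by (simp add: sum_distrib_right)
      also have "(\<Sum>j\<in>I - {i}. c j) = - c i" using c0 i sum.remove[of I i c] by simp
      finally show ?thesis .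
    qed
    have "q = D2 (\<lambda>i. l i (- h, g)) (\<lambda>i. l i (- h, g)) p"
    proof -
      have "D2 (\<lambda>i. l i (- h, g)) (\<lambda>i. l i (- h, g)) p
          = - h * D2 (\<lambda>i. l i (- h, g)) a p + g * D2 (\<lambda>i. l i (- h, g)) b p"
        using D2_combine[of "- h" _ a p g b] by (simp add: l_def algebra_simps)
      also have "\<dots> = - h * (- h * D2 a a p + g * D2 a b p) + g * (- h * D2 b a p + g * D2 b b p)"
        using D2_combine[of "- h" a a p g b] D2_combine[of "- h" b a p g b]
          D2_commute[of _ "\<lambda>i. l i (- h, g)" p] by (simp add: l_def algebra_simps)
      finally show ?thesis
        by (simp add: q_def A_def B_def C_def D2_commute[of b a] algebra_simps power2_eq_square)
    qed
    also have "\<dots> = (\<Sum>i\<in>I. l i (- h, g) * (- c i * Q (I - {i}) p))"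
      unfolding D2_def by (intro sum.cong refl) (simp only: inner)
    also have "\<dots> = (\<Sum>i\<in>I. - (c i)\<^sup>2 * Q I p)"
      by (intro sum.cong refl) (simp add: lc Q_remove[symmetric] power2_eq_square)
    also have "\<dots> = - (\<Sum>i\<in>I. (c i)\<^sup>2) * Q I p" by (simp add: sum_distrib_right sum_negf)
    finally have q: "q = - (\<Sum>i\<in>I. (c i)\<^sup>2) * Q I p" .
    have "(\<Sum>i\<in>I. (c i)\<^sup>2) \<noteq> 0"
    proof
      assume "(\<Sum>i\<in>I. (c i)\<^sup>2) = 0"
      then have "c i = 0" if "i \<in> I" for i using that by (simp add: sum_nonneg_eq_0_iff)
      then have "l i (- h, g) = 0" if "i \<in> I" for i using that lc by simp
      \<comment> \<open>Two non-proportional factors vanish together only at the origin; a zero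
        gradient, however, contradicts Euler's relation where the product is nonzero.\<close>
      then have "(- h, g) = 0" using common_zero[of 1 2 "(- h, g)"] k2 by force
      then show False using e(3) False k2 by (simp add: zero_prod_def)
    qed
    then have "(\<Sum>i\<in>I. (c i)\<^sup>2) > 0" by (simp add: sum_nonneg less_le)
    moreover have "(Q I p)\<^sup>2 > 0" using False by simp
    ultimately have "0 < m * real k * ((\<Sum>i\<in>I. (c i)\<^sup>2) * (Q I p)\<^sup>2)" using m k2 by simp
    also have "\<dots> = - ((m * real k * Q I p) * q)" unfolding q by (simp add: power2_eq_square)
    also have "m * real k * Q I p = A * x\<^sup>2 + 2 * B * x * y + C * y\<^sup>2"
      using e by algebra
    \<comment> \<open>Gram determinant of \<open>p\<close> and \<open>(- h, g)\<close> for the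
      Hessian form: it equals \<open>det M\<close> times the square of their determinant
      \<open>x * g + y * h\<close>.\<close>
    also have "(A * x\<^sup>2 + 2 * B * x * y + C * y\<^sup>2) * q
        = (- A * x * h + B * (x * g - y * h) + C * y * g)\<^sup>2 + (A * C - B\<^sup>2) * (x * g + y * h)\<^sup>2"
      unfolding q_def by algebra
    finally have "(A * C - B\<^sup>2) * (x * g + y * h)\<^sup>2 < 0"
      using zero_le_power2[of "- A * x * h + B * (x * g - y * h) + C * y * g"] by linarith
    then have "(B\<^sup>2 - A * C) * (x * g + y * h)\<^sup>2 > 0" by (simp add: algebra_simps)
    then have "B\<^sup>2 - A * C > 0" by (metis zero_le_power2 mult_pos_pos zero_less_mult_pos2 less_eq_real_def mult_zero_right less_irrefl)
    then show ?thesis by (simp add: A_def B_def C_def)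
  qed
qed

lemma card_zeros: "card {z. norm z = 1 \<and> Q I z = 0} = 2 * k"
proof -
  define n where "n i = norm (a i, b i)" for i
  \<comment> \<open>The two unit vectors on the zero line of factor \<open>i\<close>, told apart by
    the sign \<open>s\<close>.\<close>
  define w :: "nat \<times> real \<Rightarrow> real \<times> real" where "w = (\<lambda>(i, s). (s / n i) *\<^sub>R (- b i, a i))"
  have n: "n i > 0" if "i \<in> I" for i using coefficients_nonzero[OF that] by (simp add: n_def)
  have nrot: "norm (- b i, a i) = n i" for i by (simp add: n_def norm_Pair)
  have nw: "norm (w (i, s)) = 1" if "i \<in> I" "s \<in> {1, -1}" for i s
    using that n[OF that(1)] unfolding w_def split norm_scaleR nrot by auto
  have lw: "l i (w (i, s)) = 0" for i s by (simp add: w_def l_def)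
  have "bij_betw w (I \<times> {1, -1}) {z. norm z = 1 \<and> Q I z = 0}"
  proof (rule bij_betw_imageI)
    show "inj_on w (I \<times> {1, -1})"
    proof (rule inj_onI, clarify)
      fix i s j t assume *: "i \<in> I" "s \<in> {1, -1::real}" "j \<in> I" "t \<in> {1, -1::real}" "w (i, s) = w (j, t)"
      have "i = j"
        using common_zero[OF *(1,3), of "w (i, s)"] lw[of i s] lw[of j t] nw[OF *(1,2)] *(5) by force
      moreover have "s / n i = t / n j" using *(5) coefficients_nonzero[OF *(1)]
        unfolding w_def split \<open>i = j\<close> by (auto simp: zero_prod_def)
      ultimately show "i = j \<and> s = t" using n[OF *(1)] by simp
    qed
    have "w (i, s) \<in> {z. norm z = 1 \<and> Q I z = 0}" if "i \<in> I" "s \<in> {1, -1}" for i s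
      using nw[OF that] lw[of i s] that(1) by (auto simp: Q_def)
    moreover have "z \<in> w ` (I \<times> {1, -1})" if z: "norm z = 1" "Q I z = 0" for z
    proof -
      obtain i where i: "i \<in> I" "l i z = 0" using z(2) by (auto simp: Q_def)
      have "wedge z (- b i, a i) = 0" using i(2) by (simp add: wedge_def l_def algebra_simps)
      moreover have "(- b i, a i) \<noteq> 0" using coefficients_nonzero[OF i(1)] by (auto simp: zero_prod_def)
      ultimately obtain c where c: "z = c *\<^sub>R (- b i, a i)" using wedge_eq_0_imp_scaleR by blast
      then have "\<bar>c\<bar> * n i = 1" using z(1) nrot norm_scaleR by metis
      then have "c * n i \<in> {1, -1}" using n[OF i(1)] by (auto simp: abs_if split: if_splits)
      moreover have "z = w (i, c * n i)" using c n[OF i(1)] by (simp add: w_def)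
      ultimately show ?thesis using i(1) by blast
    qed
    ultimately show "w ` (I \<times> {1, -1}) = {z. norm z = 1 \<and> Q I z = 0}" by auto
  qed
  then have "card {z. norm z = 1 \<and> Q I z = 0} = card (I \<times> {1, -1 :: real})"
    by (rule bij_betw_same_card[symmetric])
  also have "\<dots> = 2 * k" by (simp add: card_cartesian_product)
  finally show ?thesis .
qed

lemma saddle_form_Q: "saddle_form k (Q I) (D1 a) (D1 b) (D2 a a) (D2 a b) (D2 b b)"
proof
  show "(Q I has_derivative (\<lambda>h. D1 a p * fst h + D1 b p * snd h)) (at p)" for p
  proof -
    have "(\<Sum>i\<in>I. l i h * Q (I - {i}) p) = D1 a p * fst h + D1 b p * snd h" for h
      using D1_combine[of "fst h" a p "snd h" b] by (simp add: D1_def l_def mult.commute)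
    then show ?thesis using Q_derivative[of I p] by simp
  qed
  show "fst p * D2 a b p + snd p * D2 b b p = (real k - 1) * D1 b p" for p
    using euler_D2[of p b] D2_commute[of a b p] by simp
qed (use k2 continuous_on_D2 euler_D1 euler_D2 D2_scaleR discriminant_pos card_zeros in auto)

end

section \<open>Both fields of the product, and their uniqueness\<close>

theorem proposition2p2:
  fixes k :: nat and a b :: "nat \<Rightarrow> real" and P :: "real \<times> real \<Rightarrow> real"
  assumes k: "k \<ge> 2"
    and P: "\<And>x y. P (x, y) = (\<Prod>i\<in>{1..k}. (a i * x + b i * y))"
    and nonproportional: "\<And>i j. i \<in> {1..k} \<Longrightarrow> j \<in> {1..k} \<Longrightarrow> i \<noteq> j \<Longrightarrow>
           \<not> (\<exists>c. a i = c * a j \<and> b i = c * b j)"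
  shows "\<exists>F G.
     asymptotic_field P F \<and> asymptotic_field P G \<and>
     (\<forall>p. p \<noteq> 0 \<longrightarrow> F p \<noteq> G p \<and> {L. asymptotic_direction P p L} = {F p, G p}) \<and>
     (\<forall>H. asymptotic_field P H \<longrightarrow> (\<forall>p. p \<noteq> 0 \<longrightarrow> H p = F p) \<or> (\<forall>p. p \<noteq> 0 \<longrightarrow> H p = G p)) \<and>
     (\<forall>H\<in>{F, G}.
        {p. singular_point H p} = (if k = 2 then {} else {0}) \<and>
        card (asymptotic_rays H) = k \<and>
        (\<forall>R\<in>asymptotic_rays H. \<exists>\<theta>. R = ray 0 \<theta>) \<and>
        (\<forall>\<alpha> \<beta>. adjacent_asymptotic_rays H \<alpha> \<beta> \<longrightarrow> hyperbolic_sector H \<alpha> \<beta>))"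
proof -
  interpret linear_forms k a b using k nonproportional by unfold_locales auto
  have PQ: "P = Q {1..k}" by (rule ext) (auto simp: P Q_def l_def)
  interpret s: saddle_form k P "D1 a" "D1 b" "D2 a a" "D2 a b" "D2 b b"
    unfolding PQ by (rule saddle_form_Q)
  interpret m: saddle_form k "\<lambda>p. - P p" "\<lambda>p. - D1 a p" "\<lambda>p. - D1 b p" "\<lambda>p. - D2 a a p" "\<lambda>p. - D2 a b p" "\<lambda>p. - D2 b b p"
    by (rule s.saddle_form_uminus)
  have dir: "{L. asymptotic_direction P p L} = {s.F p, m.F p}" if "p \<noteq> 0" for p
    using isotropic_lines[OF discriminant_pos[OF that]]
    unfolding asymptotic_direction_def PQ second_fundamental_form_Q s.F_def m.F_def .
  have ne: "s.F p \<noteq> m.F p" if p: "p \<noteq> 0" for p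
  proof -
    obtain w where "w \<in> s.F p" "w \<noteq> 0" using s.F_nonzero[OF p] .
    then show ?thesis
      using null_lines_disjoint[OF discriminant_pos[OF p]] unfolding s.F_def m.F_def by blast
  qed
  have fields: "asymptotic_field P s.F" "asymptotic_field P m.F"
    unfolding asymptotic_field_def using dir s.line_field_on_F[of "- {0}"] m.line_field_on_F[of "- {0}"] by blast+
  have unique: "(\<forall>p. p \<noteq> 0 \<longrightarrow> H p = s.F p) \<or> (\<forall>p. p \<noteq> 0 \<longrightarrow> H p = m.F p)"
    if H: "asymptotic_field P H" for H
  proof -
    have line: "line_field_on (- {0}) H" using H by (simp add: asymptotic_field_def)
    have or: "H p = s.F p \<or> H p = m.F p" if "p \<noteq> 0" for p
      using H dir[OF that] that unfolding asymptotic_field_def by blast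
    have eq: "H p \<subseteq> s.F p \<longleftrightarrow> H p = s.F p" "H p \<subseteq> m.F p \<longleftrightarrow> H p = m.F p" if p: "p \<noteq> 0" for p
    proof -
      have sub: "\<not> s.F p \<subseteq> m.F p" "\<not> m.F p \<subseteq> s.F p"
      proof -
        obtain v w where "v \<in> s.F p" "v \<noteq> 0" "w \<in> m.F p" "w \<noteq> 0"
          using s.F_nonzero[OF p] m.F_nonzero[OF p] by metis
        moreover have "u = 0" if "u \<in> s.F p" "u \<in> m.F p" for u
          using null_lines_disjoint[OF discriminant_pos[OF p]] that unfolding s.F_def m.F_def .
        ultimately show "\<not> s.F p \<subseteq> m.F p" "\<not> m.F p \<subseteq> s.F p" by blast+
      qed
      then show "H p \<subseteq> s.F p \<longleftrightarrow> H p = s.F p" "H p \<subseteq> m.F p \<longleftrightarrow> H p = m.F p" using or[OF p] by auto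
    qed
    \<comment> \<open>Where \<open>H\<close> is not \<open>s.F\<close> it is \<open>m.F\<close>, and
      conversely. The two sets are open, disjoint and cover the connected punctured plane, so one of
      them is empty.\<close>
    have "{p. p \<noteq> 0 \<and> \<not> H p \<subseteq> s.F p} \<inter> - {0} = {} \<or> {p. p \<noteq> 0 \<and> \<not> H p \<subseteq> m.F p} \<inter> - {0} = {}"
    proof (rule connectedD)
      show "connected (- {0 :: real \<times> real})" by (rule connected_punctured_universe) simp
      show "{p. p \<noteq> 0 \<and> \<not> H p \<subseteq> s.F p} \<inter> {p. p \<noteq> 0 \<and> \<not> H p \<subseteq> m.F p} \<inter> - {0} = {}"
        using or by auto
      show "- {0} \<subseteq> {p. p \<noteq> 0 \<and> \<not> H p \<subseteq> s.F p} \<union> {p. p \<noteq> 0 \<and> \<not> H p \<subseteq> m.F p}"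
      proof
        fix p :: "real \<times> real" assume "p \<in> - {0}"
        then have "p \<noteq> 0" by simp
        then show "p \<in> {p. p \<noteq> 0 \<and> \<not> H p \<subseteq> s.F p} \<union> {p. p \<noteq> 0 \<and> \<not> H p \<subseteq> m.F p}"
          using eq[of p] ne[of p] by auto
      qed
    qed (fact s.open_not_subset_F[OF line] m.open_not_subset_F[OF line])+
    then show ?thesis using eq by auto
  qed
  have props: "{p. singular_point H p} = (if k = 2 then {} else {0}) \<and>
        card (asymptotic_rays H) = k \<and>
        (\<forall>R\<in>asymptotic_rays H. \<exists>\<theta>. R = ray 0 \<theta>) \<and>
        (\<forall>\<alpha> \<beta>. adjacent_asymptotic_rays H \<alpha> \<beta> \<longrightarrow> hyperbolic_sector H \<alpha> \<beta>)" if "H \<in> {s.F, m.F}" for H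
    using that
  proof (elim insertE emptyE)
    show ?thesis if "H = s.F"
      unfolding that using s.singular_points_F s.card_asymptotic_rays s.asymptotic_rays_eq s.hyperbolic_sector_F
      by (intro conjI) auto
    show ?thesis if "H = m.F"
      unfolding that using m.singular_points_F m.card_asymptotic_rays m.asymptotic_rays_eq m.hyperbolic_sector_F
      by (intro conjI) auto
  qed
  show ?thesis
  proof (rule exI[of _ s.F], rule exI[of _ m.F], intro conjI)
    show "\<forall>p. p \<noteq> 0 \<longrightarrow> s.F p \<noteq> m.F p \<and> {L. asymptotic_direction P p L} = {s.F p, m.F p}"
      using dir ne by blast
    show "\<forall>H. asymptotic_field P H \<longrightarrow> (\<forall>p. p \<noteq> 0 \<longrightarrow> H p = s.F p) \<or> (\<forall>p. p \<noteq> 0 \<longrightarrow> H p = m.F p)"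
      by (intro allI impI unique)
  qed (fact fields, fact fields, intro ballI props)
qed

end
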